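(* Let $A\in\mathbb{R}^{n\times n}$, $B\in\mathbb{R}^{n\times m}$ with $(A,B)$ controllable, and let $Q_x\in\mathbb{R}^{n\times n}$, $R\in\mathbb{R}^{m\times m}$ be symmetric with $Q_x\succeq0$, $R\succ0$ and $(Q_x,A)$ observable. Consider the system $$x(k+1)=Ax(k)+Bu(k)+\xi(k),\qquad z(k)=\begin{bmatrix}Q_x^{1/2} & 0 \\ 0 & R^{1/2}\end{bmatrix}\begin{bmatrix} x(k) \\ {u(k)} \end{bmatrix}.$$ Let $u_d(0),\dots,u_d(T-1)\in\mathbb{R}^m$, $x_d(0),\dots,x_d(T)\in\mathbb{R}^n$ be data satisfying $x_d(k+1)=Ax_d(k)+Bu_d(k)$ for $k=0,\dots,T-1$, let $U_{0,1,T},X_{0,T},X_{1,T}$ be the data matrices defined in the context, and suppose that $$\operatorname{rank}\begin{bmatrix}U_{0,1,T}\\ X_{0,T}\end{bmatrix}=n+m .$$ Then the optimal $H_2$ state-feedback controller $K$ for this system (defined in the context) can be computed as $$K=U_{0,1,T}\,Q\,(X_{0,T}Q)^{-1},$$ where $Q\in\mathbb{R}^{T\times n}$ (together with some symmetric $X\in\mathbb{R}^{m\times m}$) is an optimal solution of $$\min_{Q,X}\ \operatorname{trace}(Q_xX_{0,T}Q)+\operatorname{trace}(X)$$ subject to $$\begin{bmatrix}X& R^{1/2}U_{0,1,T}Q\\ Q^\top U_{0,1,T}^\top R^{1/2}& X_{0,T}Q\end{bmatrix}\succeq0,\qquad \begin{bmatrix}X_{0,T}Q-I_n& X_{1,T}Q\\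 Q^\top X_{1,T}^\top& X_{0,T}Q\end{bmatrix}\succeq0 .$$ That is, this problem has an optimal solution, and every optimal solution $(Q,X)$ yields the optimal $H_2$ state-feedback gain through the formula $K=U_{0,1,T}\,Q\,(X_{0,T}Q)^{-1}$.
   Context: Data matrices: $U_{0,1,T}=[u_d(0)\ \cdots\ u_d(T-1)]\in\mathbb{R}^{m\times T}$, $X_{0,T}=[x_d(0)\ \cdots\ x_d(T-1)]\in\mathbb{R}^{n\times T}$, $X_{1,T}=[x_d(1)\ \cdots\ x_d(T)]\in\mathbb{R}^{n\times T}$. $M\succeq0$ (resp. $M\succ0$) means $M$ is symmetric and positive semidefinite (resp. definite); in particular the constraints include symmetry of $X_{0,T}Q$. $M^{1/2}$ is the symmetric positive semidefinite square root. Optimal $H_2$ state-feedback controller: the gain $K\in\mathbb{R}^{m\times n}$ which, among all $K$ such that $A+BK$ is stable (all eigenvalues of modulus strictly less than $1$), minimizes the $H_2$ norm of the closed-loop transfer function $h:\xi\to z$ obtained with $u=Kx$, where $$\|h\|_2=\Big[\tfrac1{2\pi}\int_0^{2\pi}\operatorname{trace}\big(h(e^{j\theta})^{*}h(e^{j\theta})\big)\,d\theta\Big]^{1/2},\qquad h(\zeta)=\begin{bmatrix}Q_x^{1/2} \\ R^{1/2}K\end{bmatrix}(\zeta I_n-(A+BK))^{-1},$$ and $*$ denotes conjugate transpose. Equivalently, $\|h\|_2^2=\operatorname{trace}(Q_xW_c+K^\top RKW_c)$, where $W_c$ is the solution of $(A+BK)W_c(A+BK)^\top-W_c+I_n=0$.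 This minimizer is unique and equals $-(R+B^\top PB)^{-1}B^\top PA$, where $P$ is the unique positive definite solution of the discrete-time algebraic Riccati equation $A^\top PA-P-A^\top PB(R+B^\top PB)^{-1}B^\top PA+Q_x=0$. *)

theory Defs
  imports "HOL-Analysis.Analysis"
begin

text \<open>
  Products and powers of matrices: \<open>**\<close> is the matrix product, whereas the power \<open>^\<close>
  on the type of vectors of vectors acts componentwise, hence the separate definition.
\<close>

primrec mat_pow :: "'a::semiring_1^'n^'n \<Rightarrow> nat \<Rightarrow> 'a^'n^'n" where
  "mat_pow A 0 = mat 1"
| "mat_pow A (Suc k) = A ** mat_pow A k"

definition vstack :: "'a^'c^'p \<Rightarrow> 'a^'c^'q \<Rightarrow> 'a^'c^('p + 'q)" where
  "vstack M N = (\<chi> i. case i of Inl p \<Rightarrow> M $ p | Inr q \<Rightarrow> N $ q)"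

definition block2 ::
  "'a^'r^'p \<Rightarrow> 'a^'s^'p \<Rightarrow> 'a^'r^'q \<Rightarrow> 'a^'s^'q \<Rightarrow> 'a^('r + 's)^('p + 'q)" where
  "block2 M11 M12 M21 M22 = (\<chi> i j.
     case i of
       Inl p \<Rightarrow> (case j of Inl r \<Rightarrow> M11 $ p $ r | Inr s \<Rightarrow> M12 $ p $ s)
     | Inr q \<Rightarrow> (case j of Inl r \<Rightarrow> M21 $ q $ r | Inr s \<Rightarrow> M22 $ q $ s))"

definition psd :: "real^'n^'n \<Rightarrow> bool" where
  "psd M \<longleftrightarrow> transpose M = M \<and> (\<forall>v. 0 \<le> v \<bullet> (M *v v))"

definition pos_def :: "real^'n^'n \<Rightarrow> bool" where
  "pos_def M \<longleftrightarrow> transpose M = M \<and> (\<forall>v. v \<noteq> 0 \<longrightarrow> 0 < v \<bullet> (M *v v))"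

definition psd_sqrt :: "real^'n^'n \<Rightarrow> real^'n^'n" where
  "psd_sqrt M = (THE S. psd S \<and> S ** S = M)"

text \<open>
  Kalman rank conditions: \<open>controllable A B\<close> says that \<open>[B, A B, \<dots>, A^(n-1) B]\<close> has (column)
  rank \<open>n\<close>, and \<open>observable C A\<close> that the stack of \<open>C, C A, \<dots>, C A^(n-1)\<close> has (row) rank \<open>n\<close>.
\<close>

definition controllable :: "real^'n^'n \<Rightarrow> real^'m^'n \<Rightarrow> bool" where
  "controllable A B \<longleftrightarrow>
     dim (\<Union>k<CARD('n). columns (mat_pow A k ** B)) = CARD('n)"

definition observable :: "real^'n^'p \<Rightarrow> real^'n^'n \<Rightarrow> bool" where
  "observable C A \<longleftrightarrow>
     dim (\<Union>k<CARD('n). rows (C ** mat_pow A k)) = CARD('n)"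

abbreviation cmat :: "real^'n^'m \<Rightarrow> complex^'n^'m" where
  "cmat \<equiv> map_matrix complex_of_real"

definition schur_stable :: "real^'n^'n \<Rightarrow> bool" where
  "schur_stable M \<longleftrightarrow> (\<forall>z v. v \<noteq> 0 \<and> cmat M *v v = z *s v \<longrightarrow> cmod z < 1)"

definition conj_transpose :: "complex^'n^'m \<Rightarrow> complex^'m^'n" where
  "conj_transpose M = map_matrix cnj (transpose M)"

text \<open>
  The trace of \<open>h* h\<close> is a nonnegative real number; \<open>Re\<close> only changes its type. For the transfer
  function of a stable system the integrand is continuous in \<open>\<theta>\<close>, so the integral exists.
\<close>

definition H2_norm :: "(complex \<Rightarrow> complex^'n^'m) \<Rightarrow> real" where
  "H2_norm h = sqrt (1 / (2 * pi) *
     integral {0..2 * pi} (\<lambda>\<theta>. Re (trace (conj_transpose (h (cis \<theta>)) ** h (cis \<theta>)))))"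

text \<open>
  With \<open>u = K x\<close> the system \<open>x(k+1) = A x(k) + B u(k) + \<xi>(k)\<close> with output
  \<open>z(k) = (Qx^(1/2) x(k), R^(1/2) u(k))\<close> becomes \<open>x(k+1) = (A + B K) x(k) + \<xi>(k)\<close>,
  \<open>z(k) = [Qx^(1/2); R^(1/2) K] x(k)\<close>; below is its transfer function from \<open>\<xi>\<close> to \<open>z\<close>.
  Here \<open>mat \<zeta>\<close> is \<open>\<zeta>\<close> times the identity matrix.
\<close>

definition closed_loop_tf ::
  "real^'n^'n \<Rightarrow> real^'m^'n \<Rightarrow> real^'n^'n \<Rightarrow> real^'m^'m \<Rightarrow> real^'n^'m
     \<Rightarrow> complex \<Rightarrow> complex^'n^('n + 'm)" where
  "closed_loop_tf A B Qx R K \<zeta> =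
     cmat (vstack (psd_sqrt Qx) (psd_sqrt R ** K)) ** matrix_inv (mat \<zeta> - cmat (A + B ** K))"

definition H2_optimal ::
  "real^'n^'n \<Rightarrow> real^'m^'n \<Rightarrow> real^'n^'n \<Rightarrow> real^'m^'m \<Rightarrow> real^'n^'m \<Rightarrow> bool" where
  "H2_optimal A B Qx R K \<longleftrightarrow>
     is_arg_min (\<lambda>K. H2_norm (closed_loop_tf A B Qx R K)) (\<lambda>K. schur_stable (A + B ** K)) K"

text \<open>
  The columns of a data matrix with \<open>T\<close> columns are indexed by a linearly ordered type with
  \<open>T\<close> elements; in increasing order, these stand for the sampling instants \<open>0, \<dots>, T - 1\<close>.
\<close>

definition instant :: "'t::{finite,linorder} \<Rightarrow> nat" where
  "instant t = card {s. s < t}"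

lemma strict_mono_instant: "strict_mono instant"
  unfolding strict_mono_def instant_def
  by (auto intro!: psubset_card_mono)

lemma bij_betw_instant: "bij_betw instant (UNIV :: 't::{finite,linorder} set) {..<CARD('t)}"
proof -
  have "inj (instant :: 't \<Rightarrow> nat)"
    by (rule strict_mono_imp_inj_on[OF strict_mono_instant])
  moreover have "instant t < CARD('t)" for t :: 't
    unfolding instant_def by (rule psubset_card_mono) auto
  ultimately show ?thesis
    unfolding bij_betw_def
    by (intro conjI card_subset_eq) (auto simp: card_image)
qed

definition data_matrix :: "(nat \<Rightarrow> real^'n) \<Rightarrow> (real, 't::{finite,linorder}) vec^'n" where
  "data_matrix w = (\<chi> i t. w (instant t) $ i)"

definition sdp_feasible ::
  "real^'m^'m \<Rightarrow> real^'t^'m \<Rightarrow> real^'t^'n \<Rightarrow> real^'t^'n \<Rightarrow> (real^'n^'t) \<times> (real^'m^'m) \<Rightarrow> bool" where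
  "sdp_feasible R U0 X0 X1 = (\<lambda>(Q, X).
     psd (block2 X (psd_sqrt R ** U0 ** Q)
                 (transpose Q ** transpose U0 ** psd_sqrt R) (X0 ** Q)) \<and>
     psd (block2 (X0 ** Q - mat 1) (X1 ** Q)
                 (transpose Q ** transpose X1) (X0 ** Q)))"

definition sdp_cost ::
  "real^'n^'n \<Rightarrow> real^'t^'n \<Rightarrow> (real^'n^'t) \<times> (real^'m^'m) \<Rightarrow> real" where
  "sdp_cost Qx X0 = (\<lambda>(Q, X). trace (Qx ** X0 ** Q) + trace X)"

definition sdp_optimal ::
  "real^'n^'n \<Rightarrow> real^'m^'m \<Rightarrow> real^'t^'m \<Rightarrow> real^'t^'n \<Rightarrow> real^'t^'n
     \<Rightarrow> (real^'n^'t) \<times> (real^'m^'m) \<Rightarrow> bool" where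
  "sdp_optimal Qx R U0 X0 X1 = is_arg_min (sdp_cost Qx X0) (sdp_feasible R U0 X0 X1)"

end

theory Submission
  imports Defs "HOL-Computational_Algebra.Fundamental_Theorem_Algebra"
begin

text \<open>
  By the rank condition, \<open>W = X0 Q\<close> and \<open>Y = U0 Q\<close> can be prescribed arbitrarily, and
  \<open>X1 Q = A W + B Y\<close>. The second constraint forces \<open>W \<succeq> I\<close>, so \<open>K = Y W\<^sup>-\<^sup>1\<close> makes sense and, by
  Schur complements, the constraints read \<open>X \<succeq> R\<^sup>1\<^sup>/\<^sup>2 K W K\<^sup>T R\<^sup>1\<^sup>/\<^sup>2\<close> and \<open>W \<succeq> I + M W M\<^sup>T\<close> with
  \<open>M = A + B K\<close>. Let \<open>P\<close> solve the Riccati equation, with gain \<open>K\<^sub>P\<close>. Completing the square,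
  \<open>tr(Qx W) + tr(K\<^sup>T R K W) = tr P + tr(P (W - I - M W M\<^sup>T)) + tr((K - K\<^sub>P)\<^sup>T (R + B\<^sup>T P B) (K - K\<^sub>P) W)\<close>,
  so that the optimal value is \<open>tr P\<close>, attained only for \<open>K = K\<^sub>P\<close>. The same identity with
  \<open>W = I + M W M\<^sup>T\<close> shows that \<open>K\<^sub>P\<close> is the unique minimiser of the \<open>H\<^sub>2\<close> norm.

  The solution \<open>P\<close> is the limit of value iteration from \<open>0\<close>, which is bounded because
  controllability steers every state to \<open>0\<close> in \<open>n\<close> steps; \<open>A + B K\<^sub>P\<close> is stable by observability.
\<close>

section \<open>Algebra and limits of matrix products; matrix powers\<close>

lemma matrix_add_rdistrib: "(B + C) ** A = B ** A + (C :: 'a::semiring_1^_^_) ** A"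
  by (simp add: matrix_matrix_mult_def vec_eq_iff distrib_right sum.distrib)

lemma matrix_diff_ldistrib: "A ** (B - C) = A ** B - A ** (C :: 'a::ring_1^_^_)"
  by (simp add: matrix_matrix_mult_def vec_eq_iff right_diff_distrib sum_subtractf)

lemma matrix_diff_rdistrib: "(B - C) ** A = B ** A - (C :: 'a::ring_1^_^_) ** A"
  by (simp add: matrix_matrix_mult_def vec_eq_iff left_diff_distrib sum_subtractf)

lemma matrix_minus_right: "A ** (- B) = - (A ** (B :: 'a::ring_1^_^_))"
  using matrix_diff_ldistrib[of A 0 B] by simp

lemma matrix_scaleR_left: "(c *\<^sub>R A) ** B = c *\<^sub>R (A ** (B :: 'a::real_algebra_1^_^_))"
  by (simp add: matrix_matrix_mult_def vec_eq_iff scaleR_sum_right)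

lemma matrix_scaleR_right: "A ** (c *\<^sub>R B) = c *\<^sub>R (A ** (B :: 'a::real_algebra_1^_^_))"
  by (simp add: matrix_matrix_mult_def vec_eq_iff scaleR_sum_right)

lemma transpose_add: "transpose (A + B) = transpose A + transpose B"
  by (simp add: transpose_def vec_eq_iff)

lemma transpose_diff: "transpose (A - B) = transpose A - transpose B"
  by (simp add: transpose_def vec_eq_iff)

lemma transpose_0 [simp]: "transpose 0 = 0"
  by (simp add: transpose_def vec_eq_iff)

lemmas matrix_distribs = matrix_add_ldistrib matrix_add_rdistrib matrix_diff_ldistrib
  matrix_diff_rdistrib matrix_minus_right matrix_mul_assoc
  matrix_scaleR_left matrix_scaleR_right

lemma tendsto_matrix_mult:
  fixes A B :: "'b \<Rightarrow> 'a::real_normed_algebra_1^_^_"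
  assumes "(A \<longlongrightarrow> a) F" "(B \<longlongrightarrow> b) F"
  shows "((\<lambda>x. A x ** B x) \<longlongrightarrow> a ** b) F"
  unfolding matrix_matrix_mult_def
  by (intro tendsto_vec_lambda tendsto_sum tendsto_mult tendsto_vec_nth assms)

lemma tendsto_matrix_vector_mult:
  fixes A :: "'b \<Rightarrow> 'a::real_normed_algebra_1^_^_"
  assumes "(A \<longlongrightarrow> a) F" "(x \<longlongrightarrow> y) F"
  shows "((\<lambda>t. A t *v x t) \<longlongrightarrow> a *v y) F"
  unfolding matrix_vector_mult_def
  by (intro tendsto_vec_lambda tendsto_sum tendsto_mult tendsto_vec_nth assms)

lemma mat_pow_add: "mat_pow A (i + j) = mat_pow A i ** mat_pow A j"
  by (induct i) (auto simp: matrix_mul_assoc)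

lemma mat_pow_commute: "mat_pow A k ** A = A ** mat_pow A k"
  using mat_pow_add[of A k 1] mat_pow_add[of A 1 k] by (simp add: add.commute)

subsection \<open>Positive semidefinite matrices\<close>

lemma dot_matrix_transpose: "x \<bullet> (A *v y) = (transpose A *v x) \<bullet> (y :: real^_)"
  by (simp add: dot_lmul_matrix)

lemma dot_symmetric:
  assumes "transpose M = M" shows "(M *v x) \<bullet> y = x \<bullet> (M *v (y :: real^_))"
  using assms dot_matrix_transpose by metis

lemma dot_symmetric_swap:
  assumes "transpose M = M" shows "y \<bullet> (M *v x) = x \<bullet> (M *v (y :: real^_))"
  using dot_symmetric[OF assms] by (metis inner_commute)

lemma psd_sym: "psd M \<Longrightarrow> transpose M = M"
  and psd_nonneg: "psd M \<Longrightarrow> 0 \<le> v \<bullet> (M *v v)"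
  by (auto simp: psd_def)

lemma psd_0 [simp]: "psd 0"
  by (simp add: psd_def)

lemma psd_1 [simp]: "psd (mat 1)"
  by (simp add: psd_def)

lemma psd_add: "psd M \<Longrightarrow> psd N \<Longrightarrow> psd (M + N)"
  by (simp add: psd_def transpose_add matrix_vector_mult_add_rdistrib inner_add_right)

lemma psd_scaleR: "psd M \<Longrightarrow> 0 \<le> c \<Longrightarrow> psd (c *\<^sub>R M)"
  by (simp add: psd_def transpose_scalar scaleR_matrix_vector_assoc[symmetric])

lemma psd_diffI:
  assumes "transpose M = M" "transpose N = N" "\<And>v. v \<bullet> (M *v v) \<le> v \<bullet> (N *v v)"
  shows "psd (N - M)"
  using assms by (simp add: psd_def transpose_diff matrix_vector_mult_diff_rdistrib inner_diff_right)

lemma psd_diffD: "psd (N - M) \<Longrightarrow> v \<bullet> (M *v v) \<le> v \<bullet> (N *v v)"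
  using psd_nonneg[of "N - M" v] by (simp add: matrix_vector_mult_diff_rdistrib inner_diff_right)

lemma dot_congruence: "v \<bullet> ((N ** M ** transpose N) *v v) = (transpose N *v v) \<bullet> (M *v (transpose N *v v))"
  for M :: "real^_^_"
  by (simp only: matrix_vector_mul_assoc[symmetric] dot_matrix_transpose[of v N])

lemma psd_congruence:
  assumes "psd M" shows "psd (N ** M ** transpose N)"
  unfolding psd_def dot_congruence
  using assms by (auto simp: matrix_transpose_mul psd_sym matrix_mul_assoc psd_nonneg
      simp del: transpose_matrix_vector)

text \<open>Along the line \<open>x + t *\<^sub>R y\<close> the form is a polynomial in
  \<open>t\<close> of degree at most two that is never negative. The two cases are the degenerate
  and the genuine parabola.\<close>

lemma psd_Cauchy_Schwarz:
  assumes "psd M"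
  shows "(x \<bullet> (M *v y))\<^sup>2 \<le> (x \<bullet> (M *v x)) * (y \<bullet> (M *v y))"
proof -
  let ?a = "x \<bullet> (M *v x)" and ?b = "x \<bullet> (M *v y)" and ?c = "y \<bullet> (M *v y)"
  have q: "0 \<le> ?a + 2 * t * ?b + t\<^sup>2 * ?c" for t
    using psd_nonneg[OF assms, of "x + t *\<^sub>R y"] dot_symmetric_swap[OF psd_sym[OF assms], of x y]
    by (simp add: algebra_simps inner_add power2_eq_square)
  show ?thesis
  proof (cases "?c = 0")
    case True
    have "?b = 0"
    proof (rule ccontr)
      assume "?b \<noteq> 0"
      \<comment> \<open>At this \<open>t\<close> the affine function of \<open>t\<close> takes the
        value -1.\<close>
      then show False using q[of "- (?a + 1) / (2 * ?b)"] True by (simp add: field_simps)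
    qed
    then show ?thesis using True by simp
  next
    case False
    then have "?c > 0" using psd_nonneg[OF assms, of y] by simp
    \<comment> \<open>This \<open>t\<close> is the vertex of the parabola.\<close>
    then show ?thesis using q[of "- ?b / ?c"] by (simp add: field_simps power2_eq_square)
  qed
qed

text \<open>Cauchy-Schwarz with \<open>x = M *v v\<close> bounds the fourth power of the norm of
  \<open>M *v v\<close> by 0.\<close>

lemma psd_kernel:
  assumes "psd M" "v \<bullet> (M *v v) = 0" shows "M *v v = 0"
  using psd_Cauchy_Schwarz[OF assms(1), of "M *v v" v] assms(2) by simp

lemma matrix_entry_eq_dot: "M $ i $ j = axis i 1 \<bullet> (M *v axis j (1::real))"
  by (simp add: matrix_vector_mult_basis inner_axis' column_def)

lemma trace_eq_sum_dot: "trace M = (\<Sum>i\<in>UNIV. axis i 1 \<bullet> (M *v axis i (1::real)))"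
  by (simp add: trace_def matrix_entry_eq_dot)

lemma trace_psd_nonneg: "psd M \<Longrightarrow> 0 \<le> trace M"
  unfolding trace_eq_sum_dot by (intro sum_nonneg psd_nonneg)

text \<open>The diagonal entries are nonnegative and sum to 0, so each basis vector has zero
  quadratic form and lies in the kernel.\<close>

lemma psd_trace_zero:
  assumes "psd M" "trace M = 0" shows "M = 0"
proof -
  have "axis i 1 \<bullet> (M *v axis i 1) = 0" for i
    using assms psd_nonneg[OF assms(1)] unfolding trace_eq_sum_dot
    by (subst (asm) sum_nonneg_eq_0_iff) auto
  then have "M *v axis i 1 = 0" for i
    using psd_kernel[OF assms(1)] by blast
  then have "M $ i $ j = 0" for i j by (simp only: matrix_entry_eq_dot inner_zero_right)
  then show ?thesis by (simp add: vec_eq_iff)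
qed

lemma psd_tendsto:
  assumes "P \<longlonglongrightarrow> L" "\<And>k. psd (P k)" shows "psd L"
  unfolding psd_def
proof (intro conjI allI)
  have "(\<lambda>k. transpose (P k)) \<longlonglongrightarrow> transpose L"
    unfolding transpose_def by (intro tendsto_vec_lambda tendsto_vec_nth assms)
  then show "transpose L = L"
    using assms LIMSEQ_unique by (simp add: psd_sym)
  show "0 \<le> v \<bullet> (L *v v)" for v
    by (rule tendsto_lowerbound[of "\<lambda>k. v \<bullet> (P k *v v)"])
      (auto intro!: tendsto_intros tendsto_matrix_vector_mult assms psd_nonneg
        always_eventually)
qed

text \<open>For each vector the quadratic forms are a bounded increasing real sequence; polarization
  carries convergence over to the entries.\<close>

lemma psd_mono_bounded_convergent:
  fixes P :: "nat \<Rightarrow> real^'n^'n"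
  assumes psd: "\<And>k. psd (P k)" and mono: "\<And>k. psd (P (Suc k) - P k)"
    and bdd: "\<And>x. \<exists>c. \<forall>k. x \<bullet> (P k *v x) \<le> c"
  obtains L where "P \<longlonglongrightarrow> L" "\<And>k. psd (L - P k)"
proof -
  let ?q = "\<lambda>x k. x \<bullet> (P k *v x)"
  have inc: "incseq (?q x)" for x
    by (intro incseq_SucI psd_diffD mono)
  have conv: "convergent (?q x)" for x
    using bdd[of x] inc by (metis convergent_def incseq_convergent)
  have entry: "P k $ i $ j = (?q (axis i 1 + axis j 1) k - ?q (axis i 1) k - ?q (axis j 1) k) / 2" for i j k
    using dot_symmetric_swap[OF psd_sym[OF psd], of "axis i 1" k "axis j 1"]
    by (simp add: matrix_entry_eq_dot algebra_simps inner_add)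
  have "convergent (\<lambda>k. P k $ i $ j)" for i j
    unfolding entry divide_inverse by (intro convergent_mult convergent_diff conv convergent_const)
  then have "\<exists>l. (\<lambda>k. P k $ i $ j) \<longlonglongrightarrow> l" for i j by (auto simp: convergent_def)
  then obtain l where "(\<lambda>k. P k $ i $ j) \<longlonglongrightarrow> l i j" for i j by metis
  then have L: "P \<longlonglongrightarrow> (\<chi> i j. l i j)"
    by (intro vec_tendstoI) simp
  have "psd ((\<chi> i j. l i j) - P k)" for k
  proof (rule psd_diffI)
    show "transpose (P k) = P k" by (rule psd_sym[OF psd])
    show "transpose (\<chi> i j. l i j) = (\<chi> i j. l i j)"
      by (rule psd_sym[OF psd_tendsto[OF L psd]])
    show "v \<bullet> (P k *v v) \<le> v \<bullet> ((\<chi> i j. l i j) *v v)" for v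
      by (rule incseq_le[OF inc[of v]])
        (intro tendsto_intros tendsto_matrix_vector_mult L)
  qed
  with L show ?thesis by (rule that)
qed

subsection \<open>The square root\<close>

text \<open>Products of psd matrices need not be psd, but polynomials in one psd matrix with
  nonnegative coefficients are, and they are closed under products. As a predicate on matrices,
  without coefficient lists, all closure properties are inductions.\<close>

inductive nonneg_poly :: "real^'n^'n \<Rightarrow> real^'n^'n \<Rightarrow> bool" for Z where
  zero: "nonneg_poly Z 0"
| add_term: "0 \<le> c \<Longrightarrow> nonneg_poly Z Y \<Longrightarrow> nonneg_poly Z (c *\<^sub>R mat_pow Z k + Y)"

lemma nonneg_poly_add: "nonneg_poly Z X \<Longrightarrow> nonneg_poly Z Y \<Longrightarrow> nonneg_poly Z (X + Y)"
  by (induct rule: nonneg_poly.induct) (auto simp: add.assoc intro: nonneg_poly.intros)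

lemma nonneg_poly_scaleR: "nonneg_poly Z X \<Longrightarrow> 0 \<le> c \<Longrightarrow> nonneg_poly Z (c *\<^sub>R X)"
  by (induct rule: nonneg_poly.induct) (auto simp: scaleR_add_right intro: nonneg_poly.intros)

lemma nonneg_poly_pow: "nonneg_poly Z (mat_pow Z k)"
  using nonneg_poly.add_term[of 1 Z 0 k] by (simp add: nonneg_poly.zero)

lemma nonneg_poly_pow_mult: "nonneg_poly Z Y \<Longrightarrow> nonneg_poly Z (mat_pow Z k ** Y)"
  by (induct rule: nonneg_poly.induct)
    (auto simp: matrix_distribs mat_pow_add[symmetric] intro: nonneg_poly.intros)

lemma nonneg_poly_mult: "nonneg_poly Z X \<Longrightarrow> nonneg_poly Z Y \<Longrightarrow> nonneg_poly Z (X ** Y)"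
  by (induct rule: nonneg_poly.induct)
    (auto simp: matrix_distribs intro!: nonneg_poly_add nonneg_poly_scaleR nonneg_poly_pow_mult
      intro: nonneg_poly.intros)

text \<open>The induction goes in steps of two, because Z^(j+2) = Z Z^j Z is a congruence of
  Z^j.\<close>

lemma psd_mat_pow: "psd Z \<Longrightarrow> psd (mat_pow Z k)"
proof (induct k rule: less_induct)
  case (less k)
  consider "k = 0" | "k = 1" | j where "k = Suc (Suc j)"
    by (metis One_nat_def not0_implies_Suc)
  then show ?case
  proof cases
    case 3
    then show ?thesis
      using psd_congruence[of "mat_pow Z j" Z] less
      by (simp add: psd_sym matrix_mul_assoc mat_pow_commute)
        (simp add: matrix_mul_assoc[symmetric] mat_pow_commute)
  qed (use less in auto)
qed

lemma nonneg_poly_psd: "nonneg_poly Z X \<Longrightarrow> psd Z \<Longrightarrow> psd X"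
  by (induct rule: nonneg_poly.induct) (auto intro!: psd_add psd_scaleR psd_mat_pow)

text \<open>The fixed point \<open>Y = (Z + Y\<^sup>2) / 2\<close> with \<open>Z = I - M\<close> satisfies \<open>(I - Y)\<^sup>2 = M\<close>. The iterates
  increase because their differences are polynomials in \<open>Z\<close> with nonnegative coefficients.\<close>

primrec sqrt_iter :: "real^'n^'n \<Rightarrow> nat \<Rightarrow> real^'n^'n" where
  "sqrt_iter Z 0 = 0"
| "sqrt_iter Z (Suc k) = (1/2) *\<^sub>R (Z + sqrt_iter Z k ** sqrt_iter Z k)"

lemma nonneg_poly_sqrt_iter: "nonneg_poly Z (sqrt_iter Z k)"
proof (induct k)
  case (Suc k)
  then show ?case using nonneg_poly_pow[of Z 1]
    by (auto intro!: nonneg_poly_scaleR nonneg_poly_add nonneg_poly_mult)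
qed (auto intro: nonneg_poly.intros)

lemma nonneg_poly_sqrt_iter_diff: "nonneg_poly Z (sqrt_iter Z (Suc k) - sqrt_iter Z k)"
proof (induct k)
  case 0
  show ?case using nonneg_poly_sqrt_iter[of Z 1] by simp
next
  case (Suc k)
  let ?Y = "sqrt_iter Z k" and ?Y' = "sqrt_iter Z (Suc k)"
  \<comment> \<open>The difference of two squares, split as Y'^2 - Y^2 = (Y' - Y) Y' + Y (Y' - Y),
    which holds without commutativity.\<close>
  have "sqrt_iter Z (Suc (Suc k)) - ?Y' = (1/2) *\<^sub>R ((?Y' - ?Y) ** ?Y' + ?Y ** (?Y' - ?Y))"
    by (subst (1) sqrt_iter.simps(2), subst (3) sqrt_iter.simps(2))
      (simp only: matrix_diff_ldistrib matrix_diff_rdistrib scaleR_diff_right[symmetric], simp)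
  then show ?case
    using Suc by (auto intro!: nonneg_poly_scaleR nonneg_poly_add nonneg_poly_mult nonneg_poly_sqrt_iter
      simp del: sqrt_iter.simps)
qed

text \<open>With w = Y v, Cauchy-Schwarz gives |w|^4 = (v . Y w)^2 <= (v . Y v) (w . Y w) <= |v|^2
  |w|^2, and one factor |w|^2 cancels.\<close>

lemma psd_square_le_one:
  assumes "psd Y" "psd (mat 1 - Y)" shows "psd (mat 1 - Y ** Y)"
proof (rule psd_diffI)
  show "transpose (Y ** Y) = Y ** Y"
    using assms(1) by (simp add: matrix_transpose_mul psd_sym)
  fix v
  let ?w = "Y *v v"
  have w: "v \<bullet> (Y *v ?w) = ?w \<bullet> ?w"
    by (simp add: dot_symmetric[OF psd_sym[OF assms(1)]])
  have le1: "x \<bullet> (Y *v x) \<le> x \<bullet> x" for x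
    using psd_diffD[OF assms(2), of x] by simp
  have "(?w \<bullet> ?w) * (?w \<bullet> ?w) \<le> (v \<bullet> v) * (?w \<bullet> ?w)"
    using psd_Cauchy_Schwarz[OF assms(1), of v ?w]
      mult_mono[OF le1[of v] le1[of ?w] _ psd_nonneg[OF assms(1)]]
    by (simp add: w power2_eq_square)
  then have "?w \<bullet> ?w \<le> v \<bullet> v"
    by (cases "?w \<bullet> ?w = 0") (auto simp: inner_gt_zero_iff)
  then show "v \<bullet> (Y ** Y *v v) \<le> v \<bullet> (mat 1 *v v)"
    using w by (simp add: matrix_vector_mul_assoc)
qed auto

lemma sqrt_exists_le_one:
  assumes "psd M" "psd (mat 1 - M)"
  obtains S where "psd S" "S ** S = M"
proof -
  let ?Z = "mat 1 - M" and ?Y = "sqrt_iter (mat 1 - M)"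
  have psd: "psd (?Y k)" for k
    using nonneg_poly_sqrt_iter nonneg_poly_psd assms(2) by blast
  have le1: "psd (mat 1 - ?Y k)" for k
  proof (induct k)
    case (Suc k)
    \<comment> \<open>The gap between the identity and the next iterate is the mean of
      \<open>M\<close> and I - Y^2, both psd.\<close>
    have "psd ((1/2) *\<^sub>R (M + (mat 1 - ?Y k ** ?Y k)))"
      by (intro psd_scaleR psd_add assms psd_square_le_one psd Suc) auto
    also have "(1/2) *\<^sub>R (M + (mat 1 - ?Y k ** ?Y k)) = mat 1 - ?Y (Suc k)"
      by (simp add: vec_eq_iff field_simps)
    finally show ?case .
  qed simp
  obtain L where L: "?Y \<longlonglongrightarrow> L"
  proof (rule psd_mono_bounded_convergent[of ?Y])
    show "psd (?Y (Suc k) - ?Y k)" for k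
      using nonneg_poly_sqrt_iter_diff nonneg_poly_psd assms(2) by blast
    show "\<exists>c. \<forall>k. x \<bullet> (?Y k *v x) \<le> c" for x
      using psd_diffD[OF le1] by blast
  qed (use psd in auto)
  have "(\<lambda>k. ?Y (Suc k)) \<longlonglongrightarrow> (1/2) *\<^sub>R (?Z + L ** L)"
    unfolding sqrt_iter.simps by (intro tendsto_intros tendsto_matrix_mult L)
  then have "L = (1/2) *\<^sub>R (?Z + L ** L)"
    using LIMSEQ_Suc[OF L] LIMSEQ_unique by blast
  then have "2 *\<^sub>R L = ?Z + L ** L"
    by (metis (no_types) scaleR_half_double scaleR_2 scaleR_add_right)
  \<comment> \<open>The square expands to I - 2 L + L^2 = I - Z, where Z = I - M.\<close>
  then have "(mat 1 - L) ** (mat 1 - L) = M"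
    by (simp add: matrix_distribs scaleR_2 algebra_simps)
  moreover have "psd (mat 1 - L)"
    using psd_tendsto[OF tendsto_diff[OF tendsto_const L] le1] .
  ultimately show ?thesis using that by blast
qed

text \<open>Dividing by a bound \<open>c\<close> of the operator norm reduces to a matrix below the
  identity; the root is scaled back by \<open>sqrt c\<close>.\<close>

lemma sqrt_exists:
  assumes "psd M" obtains S where "psd S" "S ** S = M"
proof -
  obtain c where c: "c > 0" "\<And>v. norm (M *v v) \<le> norm v * c"
    using bounded_linear.pos_bounded[OF matrix_vector_mul_bounded_linear[of M]] by auto
  have "psd (mat 1 - (1/c) *\<^sub>R M)"
  proof (rule psd_diffI)
    fix v
    have "v \<bullet> (M *v v) \<le> norm v * (norm v * c)"
      by (rule order_trans[OF norm_cauchy_schwarz]) (intro mult_left_mono c norm_ge_zero)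
    then show "v \<bullet> ((1/c) *\<^sub>R M *v v) \<le> v \<bullet> (mat 1 *v v)"
      using c(1) by (simp add: scaleR_matrix_vector_assoc[symmetric] field_simps dot_square_norm power2_eq_square)
  qed (use assms in \<open>auto simp: transpose_scalar psd_sym\<close>)
  moreover have "psd ((1/c) *\<^sub>R M)"
    using c assms by (intro psd_scaleR) auto
  ultimately obtain S where S: "psd S" "S ** S = (1/c) *\<^sub>R M"
    using sqrt_exists_le_one by blast
  show ?thesis
  proof (rule that)
    show "psd (sqrt c *\<^sub>R S)" using S c by (intro psd_scaleR) auto
    show "(sqrt c *\<^sub>R S) ** (sqrt c *\<^sub>R S) = M"
      using c S(2) by (simp add: matrix_distribs)
  qed
qed

text \<open>With \<open>D = S - T\<close>, the assumption says \<open>S D + D T = 0\<close>; multiplying by \<open>D\<close> and taking traces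
  kills the psd matrices \<open>D S D\<close> and \<open>D T D\<close>.\<close>

lemma sqrt_unique:
  assumes S: "psd S" and T: "psd T" and eq: "S ** S = T ** T"
  shows "S = T"
proof -
  let ?D = "S - T"
  have D: "transpose ?D = ?D" using S T by (simp add: transpose_diff psd_sym)
  have psdS: "psd (?D ** S ** ?D)" and psdT: "psd (?D ** T ** ?D)"
    using psd_congruence[OF S, of ?D] psd_congruence[OF T, of ?D] by (simp_all add: D)
  have "S ** ?D + ?D ** T = 0"
    using eq by (simp add: matrix_distribs)
  then have "?D ** (S ** ?D + ?D ** T) = 0" by simp
  then have "trace (?D ** S ** ?D) + trace (?D ** (?D ** T)) = 0"
    by (simp only: matrix_add_ldistrib matrix_mul_assoc trace_add[symmetric]) (simp add: trace_def)
  moreover have "trace (?D ** (?D ** T)) = trace (?D ** T ** ?D)"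
    by (rule trace_mul_sym)
  ultimately have "trace (?D ** S ** ?D) = 0" "trace (?D ** T ** ?D) = 0"
    using trace_psd_nonneg[OF psdS] trace_psd_nonneg[OF psdT] by linarith+
  then have "?D ** S ** ?D = 0" "?D ** T ** ?D = 0"
    using psdS psdT psd_trace_zero by blast+
  then have "(?D *v v) \<bullet> (S *v (?D *v v)) = 0 \<and> (?D *v v) \<bullet> (T *v (?D *v v)) = 0" for v
    using dot_congruence[of v ?D S] dot_congruence[of v ?D T] by (simp only: D) simp
  then have "S *v (?D *v v) = 0 \<and> T *v (?D *v v) = 0" for v
    using psd_kernel S T by blast
  then have "?D *v (?D *v v) = 0" for v
    by (simp add: matrix_vector_mult_diff_rdistrib)
  then have "(?D *v v) \<bullet> (?D *v v) = 0" for v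
    by (simp only: dot_symmetric[OF D]) simp
  then have "?D *v v = 0" for v by simp
  then show ?thesis by (simp add: matrix_eq matrix_vector_mult_diff_rdistrib)
qed

lemma psd_sqrt:
  assumes "psd M" shows psd_psd_sqrt: "psd (psd_sqrt M)" and psd_sqrt_square: "psd_sqrt M ** psd_sqrt M = M"
proof -
  have "\<exists>!S. psd S \<and> S ** S = M"
    using sqrt_exists[OF assms] sqrt_unique by metis
  from theI'[OF this] show "psd (psd_sqrt M)" "psd_sqrt M ** psd_sqrt M = M"
    unfolding psd_sqrt_def by auto
qed

lemma tendsto_transpose:
  "(F \<longlongrightarrow> G) net \<Longrightarrow> ((\<lambda>x. transpose (F x)) \<longlongrightarrow> transpose G) net"
  unfolding transpose_def by (intro tendsto_vec_lambda tendsto_vec_nth)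

subsection \<open>The Riccati equation\<close>

lemma dot_congruence_transpose:
  "v \<bullet> ((transpose K ** M ** K) *v v) = (K *v v) \<bullet> (M *v (K *v v))" for M :: "real^_^_"
  using dot_congruence[of v "transpose K" M] by simp

lemma psd_congruence_transpose: "psd M \<Longrightarrow> psd (transpose K ** M ** K)"
  using psd_congruence[of M "transpose K"] by simp

lemma pos_def_psd: "pos_def M \<Longrightarrow> psd M"
  by (metis inner_zero_left order_less_imp_le order_refl pos_def_def psd_def)

lemma pos_def_sym: "pos_def M \<Longrightarrow> transpose M = M"
  by (simp add: pos_def_def)

lemma pos_def_add_psd: "pos_def M \<Longrightarrow> psd N \<Longrightarrow> pos_def (M + N)"
  by (simp add: pos_def_def psd_def transpose_add matrix_vector_mult_add_rdistrib inner_add_right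
      add_pos_nonneg)

lemma pos_def_invertible:
  assumes "pos_def M" shows "invertible M"
proof -
  have "v = 0" if "M *v v = 0" for v
    using assms that by (metis inner_zero_right order_less_irrefl pos_def_def)
  then show ?thesis
    by (simp add: invertible_left_inverse matrix_left_invertible_ker)
qed

lemma matrix_inv_mult:
  assumes "invertible (M :: 'a::semiring_1^'n^'n)"
  shows "M ** matrix_inv M = mat 1" "matrix_inv M ** M = mat 1"
  using someI_ex[OF assms[unfolded invertible_def]] unfolding matrix_inv_def by auto

text \<open>The constant is the minimum of the form on the compact unit sphere; homogeneity extends
  the bound to all vectors.\<close>

lemma pos_def_lower_bound:
  fixes M :: "real^'n^'n"
  assumes "pos_def M" obtains r where "r > 0" "\<And>v. r * (v \<bullet> v) \<le> v \<bullet> (M *v v)"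
proof -
  have "\<exists>x\<in>sphere 0 1. \<forall>y\<in>sphere 0 1. x \<bullet> (M *v x) \<le> y \<bullet> (M *v y)"
    by (intro continuous_attains_inf continuous_intros compact_sphere
        linear_continuous_on matrix_vector_mul_bounded_linear) auto
  then obtain x where x: "norm x = 1" "\<And>y. norm y = 1 \<Longrightarrow> x \<bullet> (M *v x) \<le> y \<bullet> (M *v y)"
    by auto
  show ?thesis
  proof (rule that)
    show "0 < x \<bullet> (M *v x)" using assms x(1) by (metis norm_zero pos_def_def zero_neq_one)
    fix v :: "real^'n"
    show "x \<bullet> (M *v x) * (v \<bullet> v) \<le> v \<bullet> (M *v v)"
    proof (cases "v = 0")
      case False
      then show ?thesis using x(2)[of "(1 / norm v) *\<^sub>R v"]
        by (simp add: field_simps dot_square_norm power2_eq_square matrix_vector_mult_scaleR)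
    qed auto
  qed
qed

locale linear_quadratic =
  fixes A :: "real^'n^'n" and B :: "real^'m^'n" and Qx :: "real^'n^'n" and R :: "real^'m^'m"
  assumes psd_Qx: "psd Qx" and pos_def_R: "pos_def R"
begin

definition weight :: "real^'n^'n \<Rightarrow> real^'m^'m" where
  "weight P = R + transpose B ** P ** B"

definition gain :: "real^'n^'n \<Rightarrow> real^'n^'m" where
  "gain P = - (matrix_inv (weight P) ** (transpose B ** P ** A))"

text \<open>The Riccati operator in closed-loop (Joseph) form. For psd \<open>P\<close> it agrees
  with the usual expression with a subtracted term, but as a sum of congruences it visibly preserves
  psd matrices.\<close>

definition riccati :: "real^'n^'n \<Rightarrow> real^'n^'n" where
  "riccati P = Qx + transpose (gain P) ** R ** gain P
     + transpose (A + B ** gain P) ** P ** (A + B ** gain P)"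

text \<open>The Bellman expression: stage cost plus the value \<open>P\<close> at the successor
  state. Its minimum over \<open>u\<close> is the form of \<open>riccati P\<close>.\<close>

definition step_cost :: "real^'n^'n \<Rightarrow> real^'n \<Rightarrow> real^'m \<Rightarrow> real" where
  "step_cost P x u = x \<bullet> (Qx *v x) + u \<bullet> (R *v u) + (A *v x + B *v u) \<bullet> (P *v (A *v x + B *v u))"

lemma pos_def_weight: "psd P \<Longrightarrow> pos_def (weight P)"
  unfolding weight_def by (intro pos_def_add_psd pos_def_R psd_congruence_transpose)

lemma psd_riccati: "psd P \<Longrightarrow> psd (riccati P)"
  unfolding riccati_def
  by (intro psd_add psd_congruence_transpose psd_Qx pos_def_psd[OF pos_def_R])

lemma weight_gain: "psd P \<Longrightarrow> weight P ** gain P = - (transpose B ** P ** A)"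
  unfolding gain_def
  by (simp add: matrix_minus_right matrix_mul_assoc matrix_inv_mult pos_def_invertible pos_def_weight)

lemma step_cost_gain: "step_cost P x (gain P *v x) = x \<bullet> (riccati P *v x)"
  unfolding riccati_def step_cost_def matrix_vector_mult_add_rdistrib inner_add_right
    dot_congruence_transpose
  by (simp add: matrix_vector_mul_assoc)

text \<open>The input g = \<open>gain P *v x\<close> is stationary, R g + B^T P (A x + B g) = 0,
  which kills the cross term in the expansion at g + d.\<close>

lemma step_cost_complete_square:
  assumes P: "psd P"
  shows "step_cost P x u = x \<bullet> (riccati P *v x) + (u - gain P *v x) \<bullet> (weight P *v (u - gain P *v x))"
proof -
  define g d where "g = gain P *v x" and "d = u - gain P *v x"
  define y where "y = A *v x + B *v g"
  have adj: "(B *v d) \<bullet> (P *v z) = d \<bullet> (transpose B *v (P *v z))" for z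
    using dot_matrix_transpose[of d "transpose B" "P *v z"] by simp
  have "(R *v g + transpose B *v (P *v y)) = (weight P ** gain P + transpose B ** P ** A) *v x"
    unfolding weight_def y_def g_def
    by (simp only: matrix_distribs matrix_vector_mult_add_rdistrib matrix_vector_right_distrib
        matrix_vector_mul_assoc) (simp add: algebra_simps)
  then have "R *v g + transpose B *v (P *v y) = 0"
    by (simp add: weight_gain[OF P])
  then have orth: "d \<bullet> (R *v g) + (B *v d) \<bullet> (P *v y) = 0"
    unfolding adj inner_add_right[symmetric] by simp
  have quad: "d \<bullet> (weight P *v d) = d \<bullet> (R *v d) + (B *v d) \<bullet> (P *v (B *v d))"
    unfolding weight_def by (simp only: matrix_vector_mult_add_rdistrib inner_add_right dot_congruence_transpose)
  have "step_cost P x (g + d) = step_cost P x g + d \<bullet> (weight P *v d)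
      + 2 * (d \<bullet> (R *v g) + (B *v d) \<bullet> (P *v y))"
    unfolding quad step_cost_def y_def
    using dot_symmetric_swap[OF pos_def_sym[OF pos_def_R], of g d]
      dot_symmetric_swap[OF psd_sym[OF P], of "A *v x + B *v g" "B *v d"]
    by (simp add: matrix_vector_right_distrib inner_add add.assoc[symmetric])
  then show ?thesis
    using orth step_cost_gain[of P x] by (simp add: g_def d_def)
qed

lemma riccati_le_step_cost: "psd P \<Longrightarrow> x \<bullet> (riccati P *v x) \<le> step_cost P x u"
  using step_cost_complete_square[of P x u] psd_nonneg[OF pos_def_psd[OF pos_def_weight]] by simp

text \<open>The minimizer for \<open>P'\<close> is a candidate input for \<open>P\<close>, where it
  costs no more than it does for \<open>P'\<close>.\<close>

lemma riccati_mono: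
  assumes "psd P" "psd P'" "psd (P' - P)" shows "psd (riccati P' - riccati P)"
proof (rule psd_diffI)
  fix x
  have "x \<bullet> (riccati P *v x) \<le> step_cost P x (gain P' *v x)"
    by (rule riccati_le_step_cost[OF assms(1)])
  also have "\<dots> \<le> step_cost P' x (gain P' *v x)"
    unfolding step_cost_def using psd_diffD[OF assms(3)] by simp
  finally show "x \<bullet> (riccati P *v x) \<le> x \<bullet> (riccati P' *v x)"
    by (simp add: step_cost_gain)
qed (auto intro!: psd_sym psd_riccati assms)

section \<open>Value iteration and existence of a Riccati solution\<close>

definition value_iter :: "nat \<Rightarrow> real^'n^'n" where
  "value_iter k = (riccati ^^ k) 0"

lemma value_iter_Suc: "value_iter (Suc k) = riccati (value_iter k)"
  by (simp add: value_iter_def)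

lemma psd_value_iter: "psd (value_iter k)"
  by (induct k) (simp_all add: value_iter_Suc psd_riccati, simp add: value_iter_def)

lemma value_iter_mono: "psd (value_iter (Suc k) - value_iter k)"
proof (induct k)
  case 0
  show ?case using psd_value_iter[of 1] by (simp add: value_iter_def)
next
  case (Suc k)
  then show ?case
    unfolding value_iter_Suc[of "Suc k"] value_iter_Suc[of k] 
    using riccati_mono psd_value_iter by (metis value_iter_Suc)
qed

text \<open>Boundedness passes backwards along one step of the dynamics: the optimal cost at
  \<open>x\<close> is at most a stage cost plus the cost at the successor.\<close>

lemma value_iter_bounded_step:
  assumes "\<forall>k. (A *v x + B *v u) \<bullet> (value_iter k *v (A *v x + B *v u)) \<le> c"
  shows "\<exists>c. \<forall>k. x \<bullet> (value_iter k *v x) \<le> c"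
proof -
  have Suc: "x \<bullet> (value_iter (Suc k) *v x) \<le> x \<bullet> (Qx *v x) + u \<bullet> (R *v u) + c" for k
    using riccati_le_step_cost[OF psd_value_iter[of k], of x u] assms
    unfolding value_iter_Suc step_cost_def by (smt (verit))
  \<comment> \<open>The estimate concerns \<open>Suc k\<close>; monotonicity in \<open>k\<close>
    covers every index, including 0.\<close>
  have "x \<bullet> (value_iter k *v x) \<le> x \<bullet> (value_iter (Suc k) *v x)" for k
    by (rule psd_diffD[OF value_iter_mono])
  then show ?thesis using Suc order_trans by blast
qed

text \<open>Inputs are numbered backwards in time: \<open>w j\<close> is multiplied by the highest
  power of \<open>A\<close>, so it is applied first. After that step \<open>j\<close> inputs remain,
  and with none left the state is 0.\<close>

lemma value_iter_bounded_steered: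
  assumes "mat_pow A j *v x + (\<Sum>i<j. mat_pow A i *v (B *v w i)) = 0"
  shows "\<exists>c. \<forall>k. x \<bullet> (value_iter k *v x) \<le> c"
  using assms
proof (induct j arbitrary: x)
  case (Suc j)
  have "mat_pow A j *v (A *v x + B *v w j) + (\<Sum>i<j. mat_pow A i *v (B *v w i)) = 0"
    using Suc(2) by (simp add: matrix_vector_right_distrib matrix_vector_mul_assoc mat_pow_commute
        algebra_simps)
  from Suc(1)[OF this] show ?case using value_iter_bounded_step by blast
qed auto

text \<open>The reachable vectors form a subspace containing all columns of the A^k B, and these
  span the whole space.\<close>

lemma controllable_reachable:
  assumes "controllable A B"
  obtains w where "y = (\<Sum>i<CARD('n). mat_pow A i *v (B *v w i))"
proof -
  let ?f = "\<lambda>w. \<Sum>i<CARD('n). mat_pow A i *v (B *v w i)"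
  have "subspace (range ?f)"
  proof (rule subspaceI)
    show "0 \<in> range ?f"
      by (rule range_eqI[of _ _ "\<lambda>_. 0"]) simp
    show "a + b \<in> range ?f" if "a \<in> range ?f" "b \<in> range ?f" for a b
    proof -
      from that obtain v w where "a = ?f v" "b = ?f w" by blast
      then have "a + b = ?f (\<lambda>i. v i + w i)"
        by (simp add: matrix_vector_right_distrib sum.distrib)
      then show ?thesis by (rule range_eqI[of _ ?f])
    qed
    show "c *\<^sub>R a \<in> range ?f" if "a \<in> range ?f" for c a
    proof -
      from that obtain v where "a = ?f v" by blast
      then have "c *\<^sub>R a = ?f (\<lambda>i. c *\<^sub>R v i)"
        by (simp add: matrix_vector_mult_scaleR scaleR_sum_right)
      then show ?thesis by (rule range_eqI[of _ ?f])
    qed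
  qed
  moreover have "(\<Union>k<CARD('n). columns (mat_pow A k ** B)) \<subseteq> range ?f"
  proof safe
    fix k x assume k: "k < CARD('n)" and "x \<in> columns (mat_pow A k ** B)"
    then obtain j where "x = (mat_pow A k ** B) *v axis j 1"
      by (auto simp: columns_def matrix_vector_mult_basis)
    then have "x = mat_pow A k *v (B *v axis j 1)"
      by (simp only: matrix_vector_mul_assoc)
    also have "\<dots> = (\<Sum>i<CARD('n). if i = k then mat_pow A k *v (B *v axis j 1) else 0)"
      using k by simp
    also have "\<dots> = ?f (\<lambda>i. if i = k then axis j 1 else 0)"
      by (rule sum.cong) auto
    finally show "x \<in> range ?f" by (rule range_eqI[of _ ?f])
  qed
  ultimately have "span (\<Union>k<CARD('n). columns (mat_pow A k ** B)) \<subseteq> range ?f"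
    by (rule span_minimal[rotated])
  moreover have "span (\<Union>k<CARD('n). columns (mat_pow A k ** B)) = UNIV"
    using assms dim_eq_full[of "\<Union>k<CARD('n). columns (mat_pow A k ** B)"] unfolding controllable_def by simp
  ultimately show ?thesis using that by blast
qed

lemma value_iter_bounded:
  assumes "controllable A B"
  shows "\<exists>c. \<forall>k. x \<bullet> (value_iter k *v x) \<le> c"
proof -
  obtain w where "- (mat_pow A CARD('n) *v x) = (\<Sum>i<CARD('n). mat_pow A i *v (B *v w i))"
    using controllable_reachable[OF assms] by blast
  then have "mat_pow A CARD('n) *v x + (\<Sum>i<CARD('n). mat_pow A i *v (B *v w i)) = 0"
    by (metis add.right_inverse)
  then show ?thesis by (rule value_iter_bounded_steered)
qed

text \<open>All weights are bounded below by \<open>R\<close>, so the error in the gain is uniformly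
  controlled by its residual \<open>weight (P k) ** E k\<close>. By the normal equation
  \<open>weight_gain\<close> the residual tends to 0.\<close>

lemma tendsto_gain:
  assumes P: "P \<longlonglongrightarrow> L" and psd: "\<And>k. psd (P k)"
  shows "(\<lambda>k. gain (P k)) \<longlonglongrightarrow> gain L"
proof -
  have psdL: "psd L" using psd_tendsto[OF P psd] .
  obtain r where r: "r > 0" "\<And>v. r * (v \<bullet> v) \<le> v \<bullet> (R *v v)"
    using pos_def_lower_bound[OF pos_def_R] by blast
  have coercive: "norm v \<le> norm (weight (P k) *v v) / r" for k v
  proof (cases "v = 0")
    case False
    have "r * (v \<bullet> v) \<le> v \<bullet> (weight (P k) *v v)"
      unfolding weight_def matrix_vector_mult_add_rdistrib inner_add_right
      using r(2)[of v] psd_nonneg[OF psd_congruence_transpose[OF psd]] by (smt (verit))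
    also have "\<dots> \<le> norm v * norm (weight (P k) *v v)" by (rule norm_cauchy_schwarz)
    finally show ?thesis using r(1) False
      by (simp add: dot_square_norm power2_eq_square field_simps)
  qed (use r in auto)
  define E where "E k = gain (P k) - gain L" for k
  have "(\<lambda>k. - (transpose B ** P k ** A) - weight (P k) ** gain L)
      \<longlonglongrightarrow> - (transpose B ** L ** A) - weight L ** gain L"
    unfolding weight_def by (intro tendsto_intros tendsto_matrix_mult P)
  then have SE: "(\<lambda>k. weight (P k) ** E k) \<longlonglongrightarrow> 0"
    by (simp add: E_def matrix_diff_ldistrib weight_gain psd psdL)
  have "(\<lambda>k. E k *v v) \<longlonglongrightarrow> 0" for v
  proof (rule Lim_null_comparison)
    show "\<forall>\<^sub>F k in sequentially. norm (E k *v v) \<le> norm ((weight (P k) ** E k) *v v) / r"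
      using coercive[of "E _ *v v"] by (simp add: matrix_vector_mul_assoc)
    have "(\<lambda>k. (weight (P k) ** E k) *v v) \<longlonglongrightarrow> 0 *v v"
      by (intro tendsto_matrix_vector_mult SE tendsto_const)
    then show "(\<lambda>k. norm ((weight (P k) ** E k) *v v) / r) \<longlonglongrightarrow> 0"
      using tendsto_divide_zero tendsto_norm_zero by fastforce
  qed
  then have "(\<lambda>k. (E k *v axis j 1) $ i) \<longlonglongrightarrow> 0 $ i" for i j
    by (intro tendsto_vec_nth)
  then have "(\<lambda>k. E k $ i $ j) \<longlonglongrightarrow> 0" for i j
    by (simp add: matrix_vector_mult_basis column_def)
  then have "E \<longlonglongrightarrow> 0"
    by (intro vec_tendstoI) simp
  then show ?thesis unfolding E_def by (rule LIM_zero_cancel)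
qed

lemma riccati_solution:
  assumes "controllable A B" obtains P where "psd P" "riccati P = P"
proof -
  obtain L where L: "value_iter \<longlonglongrightarrow> L"
    using psd_mono_bounded_convergent[OF psd_value_iter value_iter_mono value_iter_bounded[OF assms]] by blast
  have "(\<lambda>k. riccati (value_iter k)) \<longlonglongrightarrow> riccati L"
    unfolding riccati_def transpose_add matrix_transpose_mul
    by (intro tendsto_intros tendsto_matrix_mult tendsto_transpose L tendsto_gain psd_value_iter)
  then have "riccati L = L"
    using LIMSEQ_Suc[OF L] LIMSEQ_unique unfolding value_iter_Suc by blast
  then show ?thesis using that psd_tendsto[OF L psd_value_iter] by blast
qed

end

subsection \<open>Stability of the Riccati feedback\<close>

text \<open>Turns a complex eigenvector into two real vectors with invariant span, so that stability
  can be studied with real quadratic forms.\<close>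

lemma cmat_eigenvector_parts:
  fixes M :: "real^'n^'n"
  assumes "cmat M *v v = z *s v"
  defines "a \<equiv> \<chi> i. Re (v $ i)" and "b \<equiv> \<chi> i. Im (v $ i)"
  shows "M *v a = Re z *\<^sub>R a - Im z *\<^sub>R b" "M *v b = Re z *\<^sub>R b + Im z *\<^sub>R a"
proof -
  have "(cmat M *v v) $ i = (z *s v) $ i" for i using assms by simp
  then have *: "(\<Sum>j\<in>UNIV. of_real (M $ i $ j) * v $ j) = z * v $ i" for i
    by (simp add: matrix_vector_mult_def)
  show "M *v a = Re z *\<^sub>R a - Im z *\<^sub>R b" "M *v b = Re z *\<^sub>R b + Im z *\<^sub>R a"
    using arg_cong[OF *, of Re] arg_cong[OF *, of Im]
    by (simp_all add: vec_eq_iff matrix_vector_mult_def a_def b_def algebra_simps)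
qed

text \<open>The orbit of \<open>x\<close> stays in \<open>V\<close>, so \<open>x\<close> is
  orthogonal to all rows of the C A^k, which span the space.\<close>

lemma observable_invariant_kernel:
  fixes A :: "real^'n^'n" and V :: "(real^'n) set"
  assumes obs: "observable C A" and inv: "\<And>x. x \<in> V \<Longrightarrow> A *v x \<in> V"
    and ker: "\<And>x. x \<in> V \<Longrightarrow> C *v x = 0" and x: "x \<in> V"
  shows "x = 0"
proof -
  let ?S = "\<Union>k<CARD('n). rows (C ** mat_pow A k)"
  have "mat_pow A k *v x \<in> V" for k
    by (induct k) (auto simp: x matrix_vector_mul_assoc[symmetric] intro: inv)
  then have *: "(C ** mat_pow A k) *v x = 0" for k
    by (simp add: matrix_vector_mul_assoc[symmetric] ker)
  have "?S \<subseteq> {y. x \<bullet> y = 0}"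
  proof safe
    fix k y assume "y \<in> rows (C ** mat_pow A k)"
    then obtain i where "y = (C ** mat_pow A k) $ i" by (auto simp: rows_def row_def)
    then show "x \<bullet> y = 0" using arg_cong[OF *[of k], of "\<lambda>u. u $ i"]
      by (simp add: matrix_vector_mul_component inner_commute)
  qed
  then have "span ?S \<subseteq> {y. x \<bullet> y = 0}"
    by (intro span_minimal subspace_hyperplane)
  moreover have "span ?S = UNIV"
    using obs dim_eq_full[of ?S] unfolding observable_def by simp
  ultimately have "x \<bullet> x = 0" by blast
  then show ?thesis by simp
qed

text \<open>The form of \<open>P\<close> drops along the closed loop by the stage cost. An
  eigenvalue of modulus at least 1 would leave no drop on its eigenvector, so the stage cost
  vanishes there. Then the feedback is zero, the closed loop acts as \<open>A\<close>, and the real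
  span of the eigenvector is an unobservable invariant subspace.\<close>

lemma (in linear_quadratic) riccati_stable:
  assumes obs: "observable Qx A" and P: "psd P" "riccati P = P"
  shows "schur_stable (A + B ** gain P)"
  unfolding schur_stable_def
proof (intro allI impI, elim conjE)
  fix z v assume v: "v \<noteq> 0" and eig: "cmat (A + B ** gain P) *v v = z *s v"
  define a b where "a = (\<chi> i. Re (v $ i))" and "b = (\<chi> i. Im (v $ i))"
  let ?M = "A + B ** gain P" and ?K = "gain P"
  have Ma: "?M *v a = Re z *\<^sub>R a - Im z *\<^sub>R b" and Mb: "?M *v b = Re z *\<^sub>R b + Im z *\<^sub>R a"
    using cmat_eigenvector_parts[OF eig] by (simp_all add: a_def b_def)
  show "cmod z < 1"
  proof (rule ccontr)
    assume "\<not> cmod z < 1"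
    then have "1 \<le> (cmod z)\<^sup>2" by simp
    then have z: "1 \<le> (Re z)\<^sup>2 + (Im z)\<^sup>2" by (simp add: cmod_power2)
    let ?q = "\<lambda>x. x \<bullet> (P *v x)" and ?s = "\<lambda>x. x \<bullet> (Qx *v x) + (?K *v x) \<bullet> (R *v (?K *v x))"
    have q: "?q x = ?s x + ?q (?M *v x)" for x
      using step_cost_gain[of P x] P(2)
      by (simp add: step_cost_def matrix_vector_mul_assoc matrix_vector_mult_add_rdistrib)
    \<comment> \<open>The sum over real and imaginary parts is the Hermitian form of
      \<open>P\<close> at the eigenvector, which scales by |z|^2; the mixed terms cancel.\<close>
    have "?q (?M *v a) + ?q (?M *v b) = ((Re z)\<^sup>2 + (Im z)\<^sup>2) * (?q a + ?q b)"
      unfolding Ma Mb by (simp add: algebra_simps inner_add inner_diff power2_eq_square)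
    moreover have "\<dots> \<ge> ?q a + ?q b"
      using z psd_nonneg[OF P(1), of a] psd_nonneg[OF P(1), of b]
      by (simp add: mult_le_cancel_right1)
    ultimately have le: "?s a + ?s b \<le> 0" using q[of a] q[of b] by linarith
    have nonneg: "x \<bullet> (Qx *v x) \<ge> 0" "(?K *v x) \<bullet> (R *v (?K *v x)) \<ge> 0" for x
      using psd_nonneg psd_Qx pos_def_psd[OF pos_def_R] by blast+
    have zero: "Qx *v x = 0 \<and> ?K *v x = 0" if "x = a \<or> x = b" for x
    proof -
      have "x \<bullet> (Qx *v x) = 0" "(?K *v x) \<bullet> (R *v (?K *v x)) = 0"
        using that le nonneg[of a] nonneg[of b] by auto
      then show ?thesis
        using psd_kernel[OF psd_Qx] pos_def_R by (metis less_irrefl pos_def_def)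
    qed
    then have ABK: "?M *v a = A *v a" "?M *v b = A *v b"
      by (simp_all add: matrix_vector_mult_add_rdistrib matrix_vector_mul_assoc[symmetric])
    let ?V = "span {a, b}"
    have inV: "a \<in> ?V" "b \<in> ?V" by (auto intro: span_base)
    have "A *v x \<in> ?V \<and> Qx *v x = 0" if "x \<in> ?V" for x
      using that
    proof (induct rule: span_induct_alt)
      case (step c x y)
      have "A *v x \<in> ?V" "Qx *v x = 0"
        using step Ma Mb inV zero unfolding ABK
        by (auto intro!: span_add span_diff span_mul)
      then show ?case using step
        by (auto simp: matrix_vector_right_distrib matrix_vector_mult_scaleR intro!: span_add span_mul)
    qed (auto intro: span_zero)
    then have "a = 0" "b = 0"
      using observable_invariant_kernel[OF obs, of ?V] inV by blast+
    then have "v = 0" by (simp add: a_def b_def vec_eq_iff complex_eq_iff)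
    then show False using v by simp
  qed
qed

lemma matrix_vector_mult_axis_nth: "(A *v axis j 1) $ i = (A :: 'a::semiring_1^_^_) $ i $ j"
  by (simp add: matrix_vector_mult_def axis_def if_distrib[of "\<lambda>c. _ * c"] cong: if_cong)

subsection \<open>Powers of stable matrices\<close>

text \<open>The vector p(N) v by Horner's scheme. Acting on a vector keeps the coefficients in the
  field.\<close>

definition poly_action :: "'a::field^'n^'n \<Rightarrow> 'a poly \<Rightarrow> 'a^'n \<Rightarrow> 'a^'n" where
  "poly_action N p v = fold_coeffs (\<lambda>a x. a *s v + N *v x) p 0"

lemma poly_action_0 [simp]: "poly_action N 0 v = 0"
  by (simp add: poly_action_def)

lemma poly_action_pCons [simp]: "poly_action N (pCons a p) v = a *s v + N *v poly_action N p v"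
  by (cases "p = 0 \<and> a = 0") (auto simp: poly_action_def)

lemma poly_action_add: "poly_action N (p + q) v = poly_action N p v + poly_action N q v"
  by (induct p q rule: poly_induct2)
    (simp_all add: matrix_vector_right_distrib vector_sadd_rdistrib)

lemma poly_action_smult: "poly_action N (smult c p) v = c *s poly_action N p v"
  by (induct p) (simp_all add: vector_add_ldistrib vector_scalar_commute vector_smult_assoc)

lemma poly_action_linear_factor:
  "poly_action N ([:- z, 1:] * q) v = N *v poly_action N q v - z *s poly_action N q v"
proof -
  have "[:- z, 1:] * q = smult (- z) q + pCons 0 q" by simp
  then show ?thesis
    by (simp only: poly_action_add poly_action_smult poly_action_pCons)
      (simp add: vec_eq_iff)
qed

lemma poly_action_linear_factor_right:
  "poly_action N q (N *v v - z *s v) = N *v poly_action N q v - z *s poly_action N q v"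
  by (induct q)
    (simp_all add: matrix_vector_right_distrib matrix_vector_mult_diff_distrib vector_ssub_ldistrib
      vector_add_ldistrib vector_scalar_commute vector_smult_assoc mult.commute)

lemma poly_action_monom: "poly_action N (monom c k) v = c *s (mat_pow N k *v v)"
  by (induct k) (simp_all add: monom_0 monom_Suc vector_scalar_commute matrix_vector_mul_assoc)

lemma poly_action_sum: "poly_action N (\<Sum>i\<in>I. f i) v = (\<Sum>i\<in>I. poly_action N (f i) v)"
  by (induct I rule: infinite_finite_induct) (auto simp: poly_action_add)

text \<open>The vectors N^k v with k up to the real dimension are one too many to be independent; a
  real relation among them is the polynomial.\<close>

lemma annihilating_poly:
  fixes N :: "complex^'n^'n"
  obtains p where "p \<noteq> 0" "poly_action N p v = 0"
proof -
  let ?f = "\<lambda>k. mat_pow N k *v v" and ?d = "DIM(complex^'n)"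
  have "\<exists>c. (\<exists>k\<le>?d. c k \<noteq> 0) \<and> (\<Sum>k\<le>?d. c k *\<^sub>R ?f k) = 0"
  proof (cases "inj_on ?f {..?d}")
    case True
    then have "card (?f ` {..?d}) > ?d" by (simp add: card_image)
    then have "dependent (?f ` {..?d})" using dependent_biggerset by blast
    then obtain u where u: "\<exists>y\<in>?f ` {..?d}. u y \<noteq> 0" "(\<Sum>y\<in>?f ` {..?d}. u y *\<^sub>R y) = 0"
      by (auto simp: dependent_finite)
    have "(\<Sum>k\<le>?d. u (?f k) *\<^sub>R ?f k) = 0"
      using u(2) by (simp only: sum.reindex[OF True] o_def)
    then show ?thesis using u(1) by (intro exI[of _ "\<lambda>k. u (?f k)"]) auto
  next
    case False
    then obtain i j where ij: "i \<le> ?d" "j \<le> ?d" "i \<noteq> j" "?f i = ?f j"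
      by (auto simp: inj_on_def)
    \<comment> \<open>If two powers give the same vector, passing to the set of vectors loses the
      relation, which is therefore written down directly.\<close>
    have "(\<Sum>k\<le>?d. (of_bool (k = i) - of_bool (k = j)) *\<^sub>R ?f k) = 0"
      using ij by (simp add: scaleR_left_diff_distrib sum_subtractf if_distrib[of "\<lambda>c. c *\<^sub>R _"]
          of_bool_def cong: if_cong)
    then show ?thesis using ij
      by (intro exI[of _ "\<lambda>k. of_bool (k = i) - of_bool (k = j)"]) auto
  qed
  then obtain c where c: "\<exists>k\<le>?d. c k \<noteq> 0" "(\<Sum>k\<le>?d. c k *\<^sub>R ?f k) = 0" by blast
  let ?p = "\<Sum>k\<le>?d. monom (complex_of_real (c k)) k"
  show ?thesis
  proof (rule that)
    obtain k where k: "k \<le> ?d" "c k \<noteq> 0" using c(1) by blast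
    then have "coeff ?p k = of_real (c k)"
      by (simp add: coeff_sum)
    then show "?p \<noteq> 0" using k by (metis coeff_0 of_real_eq_0_iff)
    have "of_real r *s x = r *\<^sub>R x" for r and x :: "complex^'n"
      by (simp add: vec_eq_iff scaleR_conv_of_real[where 'a = complex])
    then show "poly_action N ?p v = 0"
      using c(2) by (simp add: poly_action_sum poly_action_monom)
  qed
qed

lemma contraction_recursion_tendsto_0:
  fixes a e :: "nat \<Rightarrow> complex"
  assumes rec: "\<And>k. a (Suc k) = z * a k + e k" and e: "e \<longlonglongrightarrow> 0" and z: "cmod z < 1"
  shows "a \<longlonglongrightarrow> 0"
proof (rule LIMSEQ_I)
  fix r :: real assume r: "0 < r"
  \<comment> \<open>This threshold makes r/2 a fixed point of the recursion: |z| r/2 + (1 - |z|) r/2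
    = r/2.\<close>
  have "0 < (1 - cmod z) * (r / 2)" using z r by simp
  then obtain K where K: "\<And>k. k \<ge> K \<Longrightarrow> cmod (e k) < (1 - cmod z) * (r / 2)"
    using LIMSEQ_D[OF e] by fastforce
  have bound: "cmod (a (j + K)) \<le> cmod z ^ j * cmod (a K) + r / 2" for j
  proof (induct j)
    case (Suc j)
    have "cmod (a (Suc j + K)) \<le> cmod z * cmod (a (j + K)) + cmod (e (j + K))"
      using rec[of "j + K"] norm_triangle_ineq[of "z * a (j + K)" "e (j + K)"] by (simp add: norm_mult)
    also have "\<dots> \<le> cmod z * (cmod z ^ j * cmod (a K) + r / 2) + (1 - cmod z) * (r / 2)"
      using Suc K[of "j + K"] by (intro add_mono mult_left_mono) auto
    also have "\<dots> = cmod z ^ Suc j * cmod (a K) + r / 2" by (simp add: field_simps)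
    finally show ?case .
  qed (use r in simp)
  have "(\<lambda>j. cmod z ^ j * cmod (a K)) \<longlonglongrightarrow> 0"
    using tendsto_mult_left_zero[OF LIMSEQ_power_zero[of "cmod z"]] z by simp
  then obtain J where J: "\<And>j. j \<ge> J \<Longrightarrow> cmod z ^ j * cmod (a K) < r / 2"
    using LIMSEQ_D[of _ 0 "r / 2"] r by fastforce
  have "cmod (a n) < r" if "n \<ge> J + K" for n
    using bound[of "n - K"] J[of "n - K"] that by fastforce
  then show "\<exists>no. \<forall>n\<ge>no. norm (a n - 0) < r" by auto
qed

text \<open>Induction on an annihilating polynomial: a root outside the open unit disc is not an
  eigenvalue and cancels, a root inside leaves a contractive recursion.\<close>

lemma poly_action_zero_imp_powers_tendsto_0:
  fixes N :: "complex^'n^'n"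
  assumes stable: "\<And>z v. v \<noteq> 0 \<Longrightarrow> N *v v = z *s v \<Longrightarrow> cmod z < 1"
  shows "p \<noteq> 0 \<Longrightarrow> poly_action N p v = 0 \<Longrightarrow> (\<lambda>k. mat_pow N k *v v) \<longlonglongrightarrow> 0"
proof (induct "degree p" arbitrary: p v rule: less_induct)
  case less
  show ?case
  proof (cases "degree p = 0")
    case True
    then obtain c where "p = [:c:]" by (rule degree_eq_zeroE)
    then have "v = 0" using less by (simp add: vec_eq_iff)
    then show ?thesis by simp
  next
    case False
    then obtain z where "poly p z = 0"
      using fundamental_theorem_of_algebra[of p] constant_degree[of p] by auto
    then obtain q where q: "p = [:- z, 1:] * q" by (metis dvdE poly_eq_0_iff_dvd)
    have q0: "q \<noteq> 0" and deg: "degree q < degree p"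
      using less(2) q by (auto simp: degree_mult_eq simp del: mult_pCons_left)
    let ?w = "poly_action N q v"
    have w: "N *v ?w - z *s ?w = 0"
      using less(3) q by (simp only: poly_action_linear_factor)
    show ?thesis
    proof (cases "cmod z < 1")
      case True
      \<comment> \<open>Polynomials in N commute, so q annihilates (N - z) v and the induction
        hypothesis applies to that vector.\<close>
      have lim: "(\<lambda>k. mat_pow N k *v (N *v v - z *s v)) \<longlonglongrightarrow> 0"
        using less(1)[OF deg q0] w by (simp only: poly_action_linear_factor_right)
      have "(\<lambda>k. (mat_pow N k *v v) $ i) \<longlonglongrightarrow> 0" for i
      proof (rule contraction_recursion_tendsto_0[OF _ _ True])
        show "(\<lambda>k. (mat_pow N k *v (N *v v - z *s v)) $ i) \<longlonglongrightarrow> 0"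
          using tendsto_vec_nth[OF lim, of i] by simp
        show "(mat_pow N (Suc k) *v v) $ i = z * (mat_pow N k *v v) $ i
            + (mat_pow N k *v (N *v v - z *s v)) $ i" for k
        proof -
          have "mat_pow N k *v (z *s v) = z *s (mat_pow N k *v v)"
            by (simp add: vec_eq_iff matrix_vector_mult_def sum_distrib_left algebra_simps)
          then show ?thesis
            by (simp add: matrix_vector_mult_diff_distrib matrix_vector_mul_assoc mat_pow_commute)
        qed
      qed
      then show ?thesis by (intro vec_tendstoI) simp
    next
      case False
      then have "?w = 0" using stable w by (metis eq_iff_diff_eq_0)
      then show ?thesis using less(1)[OF deg q0] by blast
    qed
  qed
qed

lemma cmat_mult: "cmat (M ** N) = cmat M ** cmat N"
  by (simp add: vec_eq_iff matrix_matrix_mult_def)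

lemma cmat_1 [simp]: "cmat (mat 1) = mat 1"
  by (simp add: vec_eq_iff mat_def)

lemma cmat_add: "cmat (M + N) = cmat M + cmat N"
  by (simp add: vec_eq_iff)

lemma cmat_mat_pow: "cmat (mat_pow M k) = mat_pow (cmat M) k"
  by (induct k) (auto simp: cmat_mult)

lemma trace_cmat: "trace (cmat M) = of_real (trace M)"
  by (simp add: trace_def)

lemma schur_stable_powers:
  assumes "schur_stable M" shows "mat_pow M \<longlonglongrightarrow> 0"
proof -
  have "(\<lambda>k. complex_of_real (mat_pow M k $ i $ j)) \<longlonglongrightarrow> of_real 0" for i j
  proof -
    obtain p where "p \<noteq> 0" "poly_action (cmat M) p (axis j 1) = 0" by (rule annihilating_poly)
    then have "(\<lambda>k. mat_pow (cmat M) k *v axis j 1) \<longlonglongrightarrow> 0"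
      using poly_action_zero_imp_powers_tendsto_0 assms unfolding schur_stable_def by blast
    from tendsto_vec_nth[OF this, of i] show ?thesis
      by (simp add: matrix_vector_mult_axis_nth flip: cmat_mat_pow)
  qed
  then have "(\<lambda>k. mat_pow M k $ i $ j) \<longlonglongrightarrow> 0" for i j
    unfolding tendsto_of_real_iff .
  then show ?thesis by (intro vec_tendstoI) simp
qed

section \<open>Stein and Lyapunov equations of stable matrices\<close>

lemma stable_stein_unique:
  assumes M: "schur_stable M" and W: "W = M ** W ** transpose M" shows "W = 0"
proof -
  \<comment> \<open>Iterating the equation yields M^k W (M^k)^T = W, and the left side tends to
    0.\<close>
  have "mat_pow M k ** W ** transpose (mat_pow M k) = W" for k
  proof (induct k)
    case (Suc k)
    have "mat_pow M (Suc k) ** W ** transpose (mat_pow M (Suc k))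
        = M ** (mat_pow M k ** W ** transpose (mat_pow M k)) ** transpose M"
      by (simp add: matrix_transpose_mul matrix_mul_assoc)
    also have "\<dots> = W" by (simp only: Suc W[symmetric])
    finally show ?case .
  qed simp
  moreover have "(\<lambda>k. mat_pow M k ** W ** transpose (mat_pow M k)) \<longlonglongrightarrow> 0 ** W ** transpose 0"
    by (intro tendsto_matrix_mult tendsto_transpose schur_stable_powers M tendsto_const)
  ultimately have "(\<lambda>k. W) \<longlonglongrightarrow> 0 ** W ** transpose 0" by simp
  then have "W = 0 ** W ** transpose 0" by (rule LIMSEQ_unique[OF tendsto_const])
  then show ?thesis by (simp add: matrix_matrix_mult_def vec_eq_iff)
qed

text \<open>In finite dimension, uniqueness for the homogeneous equation gives solvability. It also
  gives symmetry, as the transpose minus \<open>W\<close> is a homogeneous solution. The form of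
  \<open>W\<close> is nonnegative because it decreases to 0 along the orbit of the transpose of
  \<open>M\<close>.\<close>

lemma lyapunov_solution:
  fixes M :: "real^'n^'n"
  assumes M: "schur_stable M"
  obtains W where "W = mat 1 + M ** W ** transpose M" "psd W" "psd (W - mat 1)"
proof -
  let ?f = "\<lambda>W. W - M ** W ** transpose M"
  have lin: "linear ?f"
    by (rule linearI) (simp_all add: matrix_distribs scaleR_diff_right)
  have "W = 0" if "?f W = 0" for W
    by (rule stable_stein_unique[OF M that[unfolded right_minus_eq]])
  then have "inj ?f"
    unfolding linear_injective_0[OF lin] by (intro allI impI)
  then have "surj ?f" by (rule linear_injective_imp_surjective[OF lin]) (rule refl)
  then obtain W where "?f W = mat 1" using surjD[of ?f "mat 1"] by metis
  then have W: "W = mat 1 + M ** W ** transpose M" by (rule diff_eq_eq[THEN iffD1])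
  have "transpose W = mat 1 + M ** transpose W ** transpose M"
    using arg_cong[OF W, of transpose] by (simp only: transpose_add matrix_transpose_mul matrix_mul_assoc
        transpose_transpose transpose_mat)
  then have "transpose W - W = (mat 1 + M ** transpose W ** transpose M) - (mat 1 + M ** W ** transpose M)"
    by (rule arg_cong2[OF _ W])
  also have "\<dots> = M ** (transpose W - W) ** transpose M"
    by (simp only: matrix_diff_ldistrib matrix_diff_rdistrib add_diff_cancel_left)
  finally have "transpose W - W = 0" by (rule stable_stein_unique[OF M])
  then have sym: "transpose W = W" by simp
  have rec: "v \<bullet> (W *v v) = v \<bullet> v + (transpose M *v v) \<bullet> (W *v (transpose M *v v))" for v
  proof -
    have "v \<bullet> (W *v v) = v \<bullet> ((mat 1 + M ** W ** transpose M) *v v)"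
      by (rule arg_cong[OF W, of "\<lambda>W. v \<bullet> (W *v v)"])
    also have "\<dots> = v \<bullet> v + (transpose M *v v) \<bullet> (W *v (transpose M *v v))"
      by (simp only: matrix_vector_mult_add_rdistrib inner_add_right dot_congruence matrix_vector_mul_lid)
    finally show ?thesis .
  qed
  have nonneg: "0 \<le> v \<bullet> (W *v v)" for v
  proof -
    let ?v = "\<lambda>k. transpose (mat_pow M k) *v v"
    have le: "?v k \<bullet> (W *v ?v k) \<le> v \<bullet> (W *v v)" for k
    proof (induct k)
      case (Suc k)
      have "?v (Suc k) = transpose M *v ?v k"
        by (simp only: mat_pow.simps mat_pow_commute[symmetric] matrix_transpose_mul matrix_vector_mul_assoc)
      then have "?v (Suc k) \<bullet> (W *v ?v (Suc k)) \<le> ?v k \<bullet> (W *v ?v k)"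
        by (simp only: rec[of "?v k"] le_add_same_cancel2 inner_ge_zero)
      then show ?case using Suc by linarith
    qed simp
    have "?v \<longlonglongrightarrow> transpose 0 *v v"
      by (intro tendsto_matrix_vector_mult tendsto_transpose schur_stable_powers M tendsto_const)
    then have "(\<lambda>k. ?v k \<bullet> (W *v ?v k)) \<longlonglongrightarrow> (transpose 0 *v v) \<bullet> (W *v (transpose 0 *v v))"
      by (intro tendsto_inner tendsto_matrix_vector_mult tendsto_transpose schur_stable_powers M
          tendsto_const)
    then have "(\<lambda>k. ?v k \<bullet> (W *v ?v k)) \<longlonglongrightarrow> 0"
      by (simp only: transpose_0 matrix_vector_mult_0 inner_zero_left)
    then show ?thesis
      by (rule LIMSEQ_le_const2) (auto intro!: exI le simp del: transpose_matrix_vector)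
  qed
  show ?thesis
  proof (rule that[OF W])
    show "psd W" using sym nonneg by (simp add: psd_def)
    show "psd (W - mat 1)"
    proof (rule psd_diffI)
      show "v \<bullet> (mat 1 *v v) \<le> v \<bullet> (W *v v)" for v
        using nonneg[of "transpose M *v v"] by (simp only: rec[of v] matrix_vector_mul_lid le_add_same_cancel1)
    qed (simp_all add: sym)
  qed
qed

subsection \<open>The \<open>H\<^sub>2\<close> norm of a stable system\<close>

lemma conj_transpose_nth [simp]: "conj_transpose M $ i $ j = cnj (M $ j $ i)"
  by (simp add: conj_transpose_def transpose_def)

lemma conj_transpose_mult: "conj_transpose (M ** N) = conj_transpose N ** conj_transpose M"
  by (simp add: vec_eq_iff matrix_matrix_mult_def mult.commute)

lemma conj_transpose_diff: "conj_transpose (M - N) = conj_transpose M - conj_transpose N"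
  by (simp add: vec_eq_iff)

lemma conj_transpose_cmat: "conj_transpose (cmat M) = cmat (transpose M)"
  by (simp add: vec_eq_iff transpose_def)

lemma conj_transpose_mat: "conj_transpose (mat z) = mat (cnj z)"
  by (simp add: vec_eq_iff mat_def)

lemma trace_conj_transpose: "trace (conj_transpose M) = cnj (trace M)"
  by (simp add: trace_def)

lemma mat_mult_nth [simp]: "(mat z ** X) $ i $ j = z * X $ i $ j"
  by (simp add: matrix_matrix_mult_def mat_def if_distrib[of "\<lambda>c. c * _"] cong: if_cong)

lemma mult_mat_nth [simp]: "(X ** mat z) $ i $ j = X $ i $ j * z"
  by (simp add: matrix_matrix_mult_def mat_def if_distrib[of "\<lambda>c. _ * c"] cong: if_cong)

lemma mat_vector_mult: "mat z *v x = z *s x"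
  by (simp add: vec_eq_iff matrix_vector_mult_def mat_def if_distrib[of "\<lambda>c. c * _"] cong: if_cong)

lemma trace_mat_mult: "trace (mat z ** X) = z * trace X"
  by (simp add: trace_def sum_distrib_left)

lemma invertible_resolvent:
  assumes "schur_stable M" "1 \<le> cmod z"
  shows "invertible (mat z - cmat M)"
proof -
  have "x = 0" if "(mat z - cmat M) *v x = 0" for x
  proof (rule ccontr)
    assume "x \<noteq> 0"
    moreover have "cmat M *v x = z *s x"
      using that by (simp add: matrix_vector_mult_diff_rdistrib mat_vector_mult)
    ultimately show False using assms unfolding schur_stable_def by force
  qed
  then show ?thesis
    by (simp add: invertible_left_inverse matrix_left_invertible_ker)
qed

lemma continuous_on_det:
  fixes F :: "'b::topological_space \<Rightarrow> complex^'n^'n"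
  assumes "\<And>i j. continuous_on S (\<lambda>t. F t $ i $ j)"
  shows "continuous_on S (\<lambda>t. det (F t))"
  unfolding det_def by (intro continuous_intros assms)

text \<open>By Cramer's rule each entry is a quotient of determinants with nonzero
  denominator.\<close>

lemma continuous_on_matrix_inv_nth:
  fixes F :: "'b::topological_space \<Rightarrow> complex^'n^'n"
  assumes F: "\<And>i j. continuous_on S (\<lambda>t. F t $ i $ j)" and inv: "\<And>t. t \<in> S \<Longrightarrow> invertible (F t)"
  shows "continuous_on S (\<lambda>t. matrix_inv (F t) $ k $ l)"
proof -
  let ?b = "axis l 1 :: complex^'n"
  have det: "det (F t) \<noteq> 0" if "t \<in> S" for t
    using inv[OF that] by (simp add: invertible_det_nz)
  have "matrix_inv (F t) $ k $ l = det (\<chi> i j. if j = k then ?b $ i else F t $ i $ j) / det (F t)"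
    if "t \<in> S" for t
  proof -
    have "F t *v (matrix_inv (F t) *v ?b) = ?b"
      by (simp add: matrix_vector_mul_assoc matrix_inv_mult inv that)
    then have "matrix_inv (F t) *v ?b
        = (\<chi> k. det (\<chi> i j. if j = k then ?b $ i else F t $ i $ j) / det (F t))"
      using cramer[OF det[OF that]] by blast
    then have "(matrix_inv (F t) *v ?b) $ k = det (\<chi> i j. if j = k then ?b $ i else F t $ i $ j) / det (F t)"
      by simp
    then show ?thesis by (simp add: matrix_vector_mult_axis_nth)
  qed
  moreover have "continuous_on S (\<lambda>t. det (\<chi> i j. if j = k then ?b $ i else F t $ i $ j) / det (F t))"
  proof (intro continuous_on_divide continuous_on_det F)
    show "continuous_on S (\<lambda>t. (\<chi> i j. if j = k then ?b $ i else F t $ i $ j) $ i $ j)" for i j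
      by (cases "j = k") (auto intro: F)
  qed (use det in auto)
  ultimately show ?thesis by (simp cong: continuous_on_cong)
qed

lemma has_integral_cis_zero:
  assumes "j > 0"
  shows "((\<lambda>\<theta>. cis (- (real j * \<theta>))) has_integral 0) {0..2 * pi}"
proof -
  let ?F = "\<lambda>\<theta>. (\<i> / of_nat j) * cis (- (real j * \<theta>))"
  have "((\<lambda>\<theta>. cis (- (real j * \<theta>))) has_integral ?F (2 * pi) - ?F 0) {0..2 * pi}"
  proof (rule fundamental_theorem_of_calculus)
    show "(?F has_vector_derivative cis (- (real j * \<theta>))) (at \<theta> within {0..2 * pi})" for \<theta>
      unfolding has_vector_derivative_def using assms
      by (auto intro!: derivative_eq_intros simp: fun_eq_iff field_simps scaleR_conv_of_real)
  qed simp
  moreover have "cis (- (real j * (2 * pi))) = 1"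
    using cis_multiple_2pi[of "- real j"] by (simp add: mult_ac)
  ultimately show ?thesis by simp
qed

lemma cmod_trace_mult_le:
  fixes X Y :: "complex^'n^'n"
  assumes "\<And>i j. cmod (Y $ i $ j) \<le> b"
  shows "cmod (trace (X ** Y)) \<le> (\<Sum>i\<in>UNIV. \<Sum>j\<in>UNIV. cmod (X $ i $ j)) * b"
  unfolding trace_def matrix_matrix_mult_def sum_distrib_right
  by (auto intro!: sum_norm_le mult_left_mono assms simp: norm_mult)

text \<open>The mean over the unit circle is the value at infinity of the resolvent.\<close>

lemma has_integral_trace_resolvent:
  fixes M :: "real^'n^'n"
  assumes M: "schur_stable M"
  shows "((\<lambda>\<theta>. trace (matrix_inv (mat (cis \<theta>) - cmat M) ** E)) has_integral 0) {0..2 * pi}"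
proof -
  let ?G = "\<lambda>\<theta>. matrix_inv (mat (cis \<theta>) - cmat M)"
  let ?t = "\<lambda>k \<theta>. trace (mat_pow (cmat M) k ** (?G \<theta> ** E))"
  \<comment> \<open>The plan: \<open>?I k\<close> is independent of \<open>k\<close> and tends to 0
    as \<open>k\<close> grows, so \<open>?I 0\<close>, the integral in question, is 0.\<close>
  let ?I = "\<lambda>k. integral {0..2 * pi} (\<lambda>\<theta>. cis (- (real k * \<theta>)) * ?t k \<theta>)"
  have inv: "invertible (mat (cis \<theta>) - cmat M)" for \<theta>
    by (rule invertible_resolvent[OF M]) simp
  have "continuous_on S (\<lambda>\<theta>. (mat (cis \<theta>) - cmat M) $ i $ j)" for S i j
    by (cases "i = j") (auto simp: mat_def intro!: continuous_intros)
  then have contG: "continuous_on S (\<lambda>\<theta>. ?G \<theta> $ i $ j)" for S i j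
    by (rule continuous_on_matrix_inv_nth[OF _ inv])
  have contGE: "continuous_on S (\<lambda>\<theta>. (?G \<theta> ** E) $ i $ j)" for S i j
    unfolding matrix_matrix_mult_def by (auto intro!: continuous_intros contG)
  have cont: "continuous_on S (\<lambda>\<theta>. ?t k \<theta>)" for S k
    unfolding trace_def matrix_matrix_mult_def[of "mat_pow _ _"]
    by (auto intro!: continuous_intros contGE)
  have contt: "continuous_on S (\<lambda>\<theta>. cis (- (real k * \<theta>)) * ?t k \<theta>)" for S k
    by (intro continuous_intros cont)
  \<comment> \<open>This is the resolvent identity z G = I + M G at z = \<open>cis \<theta>\<close>,
    multiplied by M^k and traced against E.\<close>
  have step: "?t k \<theta> = cis (- \<theta>) * (trace (mat_pow (cmat M) k ** E) + ?t (Suc k) \<theta>)" for k \<theta>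
  proof -
    have "mat (cis \<theta>) ** ?G \<theta> - cmat M ** ?G \<theta> = mat 1"
      using matrix_inv_mult(1)[OF inv, of \<theta>] by (simp add: matrix_diff_rdistrib)
    then have "mat (cis \<theta>) ** ?G \<theta> = mat 1 + cmat M ** ?G \<theta>"
      by (simp add: diff_eq_eq)
    then have "mat_pow (cmat M) k ** (mat (cis \<theta>) ** ?G \<theta>) ** E
        = mat_pow (cmat M) k ** (mat 1 + cmat M ** ?G \<theta>) ** E" by simp
    moreover have "mat_pow (cmat M) k ** (mat (cis \<theta>) ** ?G \<theta>) ** E
        = mat (cis \<theta>) ** (mat_pow (cmat M) k ** (?G \<theta> ** E))"
    proof -
      have "mat_pow (cmat M) k ** mat (cis \<theta>) = mat (cis \<theta>) ** mat_pow (cmat M) k"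
        by (simp add: vec_eq_iff mult.commute)
      then show ?thesis by (simp add: matrix_mul_assoc)
    qed
    ultimately have "cis \<theta> * ?t k \<theta> = trace (mat_pow (cmat M) k ** E) + ?t (Suc k) \<theta>"
      by (simp add: trace_mat_mult[symmetric] trace_add[symmetric] matrix_add_ldistrib matrix_add_rdistrib
          matrix_mul_assoc mat_pow_commute)
    then have "cis (- \<theta>) * (cis \<theta> * ?t k \<theta>) = cis (- \<theta>) * (trace (mat_pow (cmat M) k ** E) + ?t (Suc k) \<theta>)"
      by simp
    then show ?thesis by (simp add: mult.assoc[symmetric] cis_mult)
  qed
  \<comment> \<open>The term split off is a constant times an exponential of frequency
    \<open>Suc k\<close>, which is never 0, so its integral vanishes.\<close>
  have I_Suc: "?I k = ?I (Suc k)" for k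
  proof -
    let ?c = "trace (mat_pow (cmat M) k ** E)"
    have "cis (- (real k * \<theta>)) * ?t k \<theta> = cis (- (real (Suc k) * \<theta>)) * ?c
        + cis (- (real (Suc k) * \<theta>)) * ?t (Suc k) \<theta>" for \<theta>
    proof -
      have "cis (- (real k * \<theta>)) * ?t k \<theta>
          = (cis (- (real k * \<theta>)) * cis (- \<theta>)) * (?c + ?t (Suc k) \<theta>)"
        by (simp only: step[of k \<theta>] mult.assoc)
      also have "cis (- (real k * \<theta>)) * cis (- \<theta>) = cis (- (real (Suc k) * \<theta>))"
        by (simp add: cis_mult algebra_simps)
      finally show ?thesis by (simp only: distrib_left)
    qed
    then have "?I k = integral {0..2 * pi} (\<lambda>\<theta>. cis (- (real (Suc k) * \<theta>)) * ?c
        + cis (- (real (Suc k) * \<theta>)) * ?t (Suc k) \<theta>)"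
      by (rule arg_cong[OF ext])
    moreover have "((\<lambda>\<theta>. cis (- (real (Suc k) * \<theta>)) * ?c
        + cis (- (real (Suc k) * \<theta>)) * ?t (Suc k) \<theta>) has_integral 0 * ?c + ?I (Suc k)) {0..2 * pi}"
      by (intro has_integral_add has_integral_mult_left has_integral_cis_zero integrable_integral
          integrable_continuous_interval contt zero_less_Suc)
    then have "integral {0..2 * pi} (\<lambda>\<theta>. cis (- (real (Suc k) * \<theta>)) * ?c
        + cis (- (real (Suc k) * \<theta>)) * ?t (Suc k) \<theta>) = 0 * ?c + ?I (Suc k)"
      by (rule integral_unique)
    ultimately show ?thesis by (simp only: mult_zero_left add_0)
  qed
  \<comment> \<open>The resolvent is bounded on the circle by compactness, uniformly in
    \<open>k\<close>; the decay comes from M^k alone.\<close>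
  have "\<exists>b. \<forall>\<theta>\<in>{0..2 * pi}. cmod ((?G \<theta> ** E) $ i $ j) \<le> b" for i j
  proof -
    have "bounded ((\<lambda>\<theta>. (?G \<theta> ** E) $ i $ j) ` {0..2 * pi})"
      by (intro compact_imp_bounded compact_continuous_image contGE compact_Icc)
    then show ?thesis by (auto simp: bounded_iff)
  qed
  then obtain c where c: "\<And>i j \<theta>. \<theta> \<in> {0..2 * pi} \<Longrightarrow> cmod ((?G \<theta> ** E) $ i $ j) \<le> c i j" by metis
  define b where "b = (\<Sum>i\<in>UNIV. \<Sum>j\<in>UNIV. \<bar>c i j\<bar>)"
  have b: "cmod ((?G \<theta> ** E) $ i $ j) \<le> b" if "\<theta> \<in> {0..2 * pi}" for i j \<theta>
  proof -
    have "\<bar>c i j\<bar> \<le> (\<Sum>j\<in>UNIV. \<bar>c i j\<bar>)" by (rule member_le_sum) auto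
    also have "\<dots> \<le> b" unfolding b_def
      by (rule member_le_sum[of i UNIV "\<lambda>i. \<Sum>j\<in>UNIV. \<bar>c i j\<bar>"]) (auto intro: sum_nonneg)
    finally show ?thesis using c[OF that, of i j] by linarith
  qed
  let ?m = "\<lambda>k. \<Sum>i\<in>UNIV. \<Sum>j\<in>UNIV. cmod (mat_pow (cmat M) k $ i $ j)"
  have bound: "cmod (?I k) \<le> ?m k * b * (2 * pi - 0)" for k
    by (rule integral_bound) (auto intro!: contt cmod_trace_mult_le b simp: norm_mult)
  have const: "?I k = ?I 0" for k
  proof (induct k)
    case (Suc k)
    show ?case by (rule trans[OF I_Suc[symmetric] Suc])
  qed (rule refl)
  have "cmod (?I 0) \<le> ?m k * b * (2 * pi - 0)" for k
    using bound[of k] by (simp only: const[of k])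
  moreover have "(\<lambda>k. ?m k * b * (2 * pi - 0)) \<longlonglongrightarrow> 0"
  proof -
    have "(\<lambda>k. complex_of_real (mat_pow M k $ i $ j)) \<longlonglongrightarrow> of_real ((0 :: real^'n^'n) $ i $ j)" for i j
      by (intro tendsto_of_real tendsto_vec_nth schur_stable_powers M)
    then have "(\<lambda>k. mat_pow (cmat M) k $ i $ j) \<longlonglongrightarrow> 0" for i j
      by (simp flip: cmat_mat_pow)
    then have "(\<lambda>k. ?m k * b * (2 * pi - 0))
        \<longlonglongrightarrow> (\<Sum>i\<in>(UNIV::'n set). \<Sum>j\<in>(UNIV::'n set). cmod 0) * b * (2 * pi - 0)"
      by (intro tendsto_mult tendsto_sum tendsto_norm tendsto_const)
    then show ?thesis by simp
  qed
  ultimately have "cmod (?I 0) \<le> 0"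
    by (intro LIMSEQ_le_const) blast+
  moreover have "((\<lambda>\<theta>. cis (- (real 0 * \<theta>)) * ?t 0 \<theta>) has_integral ?I 0) {0..2 * pi}"
    by (intro integrable_integral integrable_continuous_interval contt)
  ultimately show ?thesis by simp
qed

text \<open>On the unit circle the resolvent \<open>G\<close> satisfies \<open>G G\<^sup>* = W + G M W + (G M W)\<^sup>*\<close>, and the last two
  terms have mean \<open>0\<close>.\<close>

lemma H2_norm_stable:
  fixes M W :: "real^'n^'n" and C :: "real^'n^'p"
  assumes M: "schur_stable M" and W: "W = mat 1 + M ** W ** transpose M" and sym: "transpose W = W"
  shows "H2_norm (\<lambda>\<zeta>. cmat C ** matrix_inv (mat \<zeta> - cmat M)) = sqrt (trace (transpose C ** C ** W))"
proof -
  define D where "D = transpose C ** C"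
  have D: "transpose D = D" by (simp add: D_def matrix_transpose_mul)
  let ?G = "\<lambda>\<theta>. matrix_inv (mat (cis \<theta>) - cmat M)"
  let ?g = "\<lambda>\<theta>. trace (?G \<theta> ** cmat (M ** W ** D))"
  have trace: "trace (conj_transpose (cmat C ** ?G \<theta>) ** (cmat C ** ?G \<theta>))
      = of_real (trace (D ** W)) + (?g \<theta> + cnj (?g \<theta>))" for \<theta>
  proof -
    let ?N = "mat (cis \<theta>) - cmat M" and ?Ns = "mat (cnj (cis \<theta>)) - cmat (transpose M)"
    let ?Gs = "conj_transpose (?G \<theta>)"
    have inv: "invertible ?N" by (rule invertible_resolvent[OF M]) simp
    have GN: "?G \<theta> ** ?N = mat 1" using matrix_inv_mult[OF inv] by simp
    have "conj_transpose (?G \<theta> ** ?N) = conj_transpose (mat 1)"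
      using matrix_inv_mult[OF inv] by simp
    then have NG: "?Ns ** ?Gs = mat 1"
      by (simp only: conj_transpose_mult conj_transpose_diff conj_transpose_cmat conj_transpose_mat
          complex_cnj_one)
    \<comment> \<open>For |z| = 1, z W conj(z) = W; writing z I = N + M on both sides brings in the
      Lyapunov equation.\<close>
    have "(mat (cis \<theta>) ** cmat W) ** mat (cnj (cis \<theta>)) = cmat W"
      by (simp add: vec_eq_iff cis_mult mult_ac cis_cnj)
    then have "(?N + cmat M) ** cmat W ** (?Ns + cmat (transpose M)) = cmat W" by simp
    also have "cmat W = mat 1 + cmat M ** cmat W ** cmat (transpose M)"
      using arg_cong[OF W, of cmat] by (simp only: cmat_add cmat_mult cmat_1)
    finally have id: "?N ** cmat W ** ?Ns + cmat M ** cmat W ** ?Ns + ?N ** cmat W ** cmat (transpose M) = mat 1"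
      by (simp only: matrix_add_ldistrib matrix_add_rdistrib add.assoc[symmetric]) (simp add: add_ac)
    \<comment> \<open>Multiplying by G on the left and its adjoint on the right cancels N and its
      adjoint.\<close>
    have "?G \<theta> ** (?N ** cmat W ** ?Ns + cmat M ** cmat W ** ?Ns + ?N ** cmat W ** cmat (transpose M)) ** ?Gs
        = (?G \<theta> ** ?N) ** cmat W ** (?Ns ** ?Gs) + ?G \<theta> ** cmat M ** cmat W ** (?Ns ** ?Gs)
          + (?G \<theta> ** ?N) ** cmat W ** cmat (transpose M) ** ?Gs"
      by (simp only: matrix_add_ldistrib matrix_add_rdistrib matrix_mul_assoc)
    then have GG: "?G \<theta> ** ?Gs = cmat W + ?G \<theta> ** cmat M ** cmat W + cmat W ** cmat (transpose M) ** ?Gs"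
      by (simp only: id GN NG matrix_mul_lid matrix_mul_rid)
    have "conj_transpose (cmat C ** ?G \<theta>) ** (cmat C ** ?G \<theta>) = ?Gs ** (cmat D ** ?G \<theta>)"
      by (simp only: conj_transpose_mult conj_transpose_cmat D_def cmat_mult matrix_mul_assoc)
    then have "trace (conj_transpose (cmat C ** ?G \<theta>) ** (cmat C ** ?G \<theta>))
        = trace (cmat D ** (?G \<theta> ** ?Gs))"
      using trace_mul_sym[of ?Gs "cmat D ** ?G \<theta>"] by (simp only: matrix_mul_assoc)
    also have "\<dots> = trace (cmat D ** cmat W) + trace (cmat D ** (?G \<theta> ** cmat M ** cmat W))
        + trace (cmat D ** (cmat W ** cmat (transpose M) ** ?Gs))"
      by (simp only: GG matrix_add_ldistrib trace_add)
    also have "trace (cmat D ** (?G \<theta> ** cmat M ** cmat W)) = ?g \<theta>"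
      using trace_mul_sym[of "cmat D" "?G \<theta> ** cmat M ** cmat W"] by (simp only: cmat_mult matrix_mul_assoc)
    also have "cmat D ** (cmat W ** cmat (transpose M) ** ?Gs) = conj_transpose (?G \<theta> ** cmat (M ** W ** D))"
      by (simp only: conj_transpose_mult conj_transpose_cmat cmat_mult matrix_transpose_mul D sym matrix_mul_assoc)
    finally show ?thesis
      by (simp only: trace_conj_transpose trace_cmat cmat_mult[symmetric] add.assoc)
  qed
  have "((\<lambda>\<theta>. trace (D ** W) + 2 * Re (?g \<theta>)) has_integral (2 * pi - 0) *\<^sub>R trace (D ** W) + 2 * Re 0) {0..2 * pi}"
    using has_integral_const_real[of "trace (D ** W)" 0 "2 * pi"]
    by (intro has_integral_add has_integral_mult_right has_integral_Re has_integral_trace_resolvent[OF M]) simp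
  then have "integral {0..2 * pi} (\<lambda>\<theta>. Re (trace (conj_transpose (cmat C ** ?G \<theta>) ** (cmat C ** ?G \<theta>))))
      = 2 * pi * trace (D ** W)"
    unfolding trace by (simp add: integral_unique)
  then show ?thesis by (simp add: H2_norm_def D_def)
qed

subsection \<open>Block matrices\<close>

lemma sum_UNIV_sum_type:
  "(\<Sum>i\<in>UNIV. f i) = (\<Sum>p\<in>UNIV. f (Inl p)) + (\<Sum>q\<in>UNIV. f (Inr q))"
  for f :: "'p::finite + 'q::finite \<Rightarrow> 'a::comm_monoid_add"
  by (simp add: UNIV_Plus_UNIV[symmetric] sum.Plus del: UNIV_Plus_UNIV)

lemma vstack_nth [simp]: "vstack M N $ Inl p = M $ p" "vstack M N $ Inr q = N $ q"
  by (simp_all add: vstack_def)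

lemma vstack_eq_iff: "vstack M N = vstack M' N' \<longleftrightarrow> M = M' \<and> N = N'"
  by (simp add: vec_eq_iff[of "vstack _ _"] vec_eq_iff[of M] vec_eq_iff[of N] split_sum_all)

lemma vstack_mult: "vstack M N ** Q = vstack (M ** Q) (N ** Q)"
  by (simp add: vec_eq_iff matrix_matrix_mult_def vstack_def split: sum.split)

lemma transpose_vstack_mult: "transpose (vstack M N) ** vstack M N = transpose M ** M + transpose N ** N"
  by (simp add: vec_eq_iff matrix_matrix_mult_def transpose_def sum_UNIV_sum_type)

lemma block2_nth [simp]:
  "block2 E Z Y W $ Inl p $ Inl r = E $ p $ r" "block2 E Z Y W $ Inl p $ Inr s = Z $ p $ s"
  "block2 E Z Y W $ Inr q $ Inl r = Y $ q $ r" "block2 E Z Y W $ Inr q $ Inr s = W $ q $ s"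
  by (simp_all add: block2_def)

lemma transpose_block2: "transpose (block2 E Z Y W) = block2 (transpose E) (transpose Y) (transpose Z) (transpose W)"
  by (simp add: vec_eq_iff transpose_def block2_def split: sum.split)

lemma block2_eq_iff: "block2 E Z Y W = block2 E' Z' Y' W' \<longleftrightarrow> E = E' \<and> Z = Z' \<and> Y = Y' \<and> W = W'"
  by (auto simp: vec_eq_iff split_sum_all)

lemma dot_block2:
  fixes v :: "real^('p::finite + 'q::finite)"
  defines "a \<equiv> \<chi> p. v $ Inl p" and "b \<equiv> \<chi> q. v $ Inr q"
  shows "v \<bullet> (block2 E Z Y W *v v) = a \<bullet> (E *v a) + a \<bullet> (Z *v b) + b \<bullet> (Y *v a) + b \<bullet> (W *v b)"
  by (simp add: inner_vec_def matrix_vector_mult_def sum_UNIV_sum_type a_def b_def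
      distrib_left sum.distrib)

lemma psd_block2_iff:
  "psd (block2 E Z Y W) \<longleftrightarrow> transpose E = E \<and> transpose Z = Y \<and> transpose W = W \<and>
     (\<forall>a b. 0 \<le> a \<bullet> (E *v a) + a \<bullet> (Z *v b) + b \<bullet> (Y *v a) + b \<bullet> (W *v b))"
proof -
  have "(\<forall>v. 0 \<le> v \<bullet> (block2 E Z Y W *v v)) \<longleftrightarrow>
      (\<forall>a b. 0 \<le> a \<bullet> (E *v a) + a \<bullet> (Z *v b) + b \<bullet> (Y *v a) + b \<bullet> (W *v b))"
  proof (intro iffI allI)
    fix a b assume *: "\<forall>v. 0 \<le> v \<bullet> (block2 E Z Y W *v v)"
    show "0 \<le> a \<bullet> (E *v a) + a \<bullet> (Z *v b) + b \<bullet> (Y *v a) + b \<bullet> (W *v b)"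
      using *[rule_format, of "\<chi> i. case i of Inl p \<Rightarrow> a $ p | Inr q \<Rightarrow> b $ q"]
      unfolding dot_block2 by (simp add: vec_nth_inverse eta_contract_eq)
  qed (simp add: dot_block2)
  moreover have "transpose Y = Z \<longleftrightarrow> transpose Z = Y" by auto
  ultimately show ?thesis
    unfolding psd_def transpose_block2 block2_eq_iff by auto
qed

text \<open>Since the off-diagonal block factors through \<open>W\<close>, completing the square in
  b + F^T a requires no inverse of \<open>W\<close>.\<close>

lemma psd_Schur_complement:
  assumes W: "psd W"
  shows "psd (block2 E (F ** W) (W ** transpose F) W) \<longleftrightarrow> psd (E - F ** W ** transpose F)"
proof -
  note sym = psd_sym[OF W]
  define N where "N = E - F ** W ** transpose F"
  have tr: "transpose (F ** W) = W ** transpose F"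
    by (simp add: matrix_transpose_mul sym)
  have tN: "transpose N = N \<longleftrightarrow> transpose E = E"
    by (simp add: N_def transpose_diff matrix_transpose_mul sym matrix_mul_assoc)
  have quad: "a \<bullet> (E *v a) + a \<bullet> ((F ** W) *v b) + b \<bullet> ((W ** transpose F) *v a) + b \<bullet> (W *v b)
      = a \<bullet> (N *v a) + (b + transpose F *v a) \<bullet> (W *v (b + transpose F *v a))" for a b
  proof -
    define u where "u = transpose F *v a"
    have "a \<bullet> ((F ** W) *v b) = u \<bullet> (W *v b)"
      by (simp only: matrix_vector_mul_assoc[symmetric] dot_matrix_transpose[of a F] u_def)
    moreover have "b \<bullet> ((W ** transpose F) *v a) = b \<bullet> (W *v u)"
      by (simp only: matrix_vector_mul_assoc u_def)
    moreover have "a \<bullet> (N *v a) = a \<bullet> (E *v a) - u \<bullet> (W *v u)"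
      by (simp only: N_def matrix_vector_mult_diff_rdistrib inner_diff_right dot_congruence u_def)
    ultimately show ?thesis
      unfolding u_def[symmetric] by (simp add: matrix_vector_right_distrib inner_add)
  qed
  show ?thesis
    unfolding psd_block2_iff N_def[symmetric] psd_def[of N] tN tr quad
  proof (intro iffI conjI allI; (elim conjE)?)
    fix a assume "\<forall>a b. 0 \<le> a \<bullet> (N *v a) + (b + transpose F *v a) \<bullet> (W *v (b + transpose F *v a))"
    \<comment> \<open>This choice of \<open>b\<close> makes the completed square vanish.\<close>
    from this[rule_format, of a "- (transpose F *v a)"] show "0 \<le> a \<bullet> (N *v a)" by simp
  qed (use sym psd_nonneg[OF W] in \<open>auto intro!: add_nonneg_nonneg\<close>)
qed

subsection \<open>Optimality of the Riccati feedback\<close>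

text \<open>With S the root of \<open>M\<close>, cyclicity replaces \<open>M ** N\<close> by the
  congruence S N S.\<close>

lemma trace_psd_mult_nonneg:
  assumes "psd M" "psd N" shows "0 \<le> trace (M ** N)"
proof -
  let ?S = "psd_sqrt M"
  have "trace (M ** N) = trace (?S ** (?S ** N))"
    by (simp add: matrix_mul_assoc psd_sqrt_square assms)
  also have "\<dots> = trace (?S ** N ** transpose ?S)"
    by (simp add: trace_mul_sym[of ?S "?S ** N"] psd_sym psd_psd_sqrt assms)
  finally show ?thesis
    using trace_psd_nonneg[OF psd_congruence[OF assms(2)]] by simp
qed

lemma symmetric_matrix_eqI:
  fixes M N :: "real^'n^'n"
  assumes "transpose M = M" "transpose N = N" "\<And>v. v \<bullet> (M *v v) = v \<bullet> (N *v v)"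
  shows "M = N"
proof -
  have psd: "psd (N - M)" "psd (M - N)" using assms by (auto intro: psd_diffI)
  then have "trace (N - M) = 0"
    using trace_psd_nonneg[OF psd(1)] trace_psd_nonneg[OF psd(2)] by (simp add: trace_sub)
  then show ?thesis using psd_trace_zero[OF psd(1)] by simp
qed

context linear_quadratic
begin

text \<open>The squared H2 norm when \<open>W\<close> solves the Lyapunov equation of a stable
  closed loop. Leaving \<open>W\<close> free lets the semidefinite program use the same
  expression.\<close>

definition closed_loop_cost :: "real^'n^'m \<Rightarrow> real^'n^'n \<Rightarrow> real" where
  "closed_loop_cost K W = trace (Qx ** W) + trace (transpose K ** R ** K ** W)"

text \<open>The additional one-step cost, as a quadratic form in the state, of using
  \<open>K\<close> instead of the Riccati gain.\<close>

definition excess :: "real^'n^'n \<Rightarrow> real^'n^'m \<Rightarrow> real^'n^'n" where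
  "excess P K = transpose (K - gain P) ** weight P ** (K - gain P)"

lemma psd_excess: "psd P \<Longrightarrow> psd (excess P K)"
  unfolding excess_def by (rule psd_congruence_transpose[OF pos_def_psd[OF pos_def_weight]])

text \<open>Both sides are symmetric, and their forms agree by completing the square at the input
  \<open>K *v v\<close>.\<close>

lemma matrix_complete_square:
  assumes P: "psd P" "riccati P = P"
  shows "Qx + transpose K ** R ** K + transpose (A + B ** K) ** P ** (A + B ** K) = P + excess P K"
proof (rule symmetric_matrix_eqI)
  show "transpose (Qx + transpose K ** R ** K + transpose (A + B ** K) ** P ** (A + B ** K))
      = Qx + transpose K ** R ** K + transpose (A + B ** K) ** P ** (A + B ** K)"
    by (intro psd_sym psd_add psd_congruence_transpose P psd_Qx
        pos_def_psd[OF pos_def_R])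
  show "transpose (P + excess P K) = P + excess P K"
    by (intro psd_sym psd_add psd_excess P)
  fix v
  have "v \<bullet> ((Qx + transpose K ** R ** K + transpose (A + B ** K) ** P ** (A + B ** K)) *v v)
      = step_cost P v (K *v v)"
    unfolding step_cost_def matrix_vector_mult_add_rdistrib inner_add_right dot_congruence_transpose
    by (simp add: matrix_vector_mul_assoc)
  also have "\<dots> = v \<bullet> ((P + excess P K) *v v)"
    unfolding step_cost_complete_square[OF P(1)] excess_def P(2)
      matrix_vector_mult_add_rdistrib inner_add_right dot_congruence_transpose
    by (simp add: matrix_vector_mult_diff_rdistrib)
  finally show "v \<bullet> ((Qx + transpose K ** R ** K + transpose (A + B ** K) ** P ** (A + B ** K)) *v v)
      = v \<bullet> ((P + excess P K) *v v)" .
qed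

text \<open>Multiply the matrix identity by \<open>W\<close> and take traces. As \<open>W\<close> is
  arbitrary, the residual of the Lyapunov equation appears, weighted by \<open>P\<close>.\<close>

lemma closed_loop_cost_eq:
  assumes P: "psd P" "riccati P = P"
  shows "closed_loop_cost K W = trace P
     + trace (P ** (W - mat 1 - (A + B ** K) ** W ** transpose (A + B ** K))) + trace (excess P K ** W)"
proof -
  let ?M = "A + B ** K"
  have "trace ((Qx + transpose K ** R ** K + transpose ?M ** P ** ?M) ** W) = trace ((P + excess P K) ** W)"
    by (simp only: matrix_complete_square[OF P])
  moreover have "trace (transpose ?M ** P ** ?M ** W) = trace (P ** (?M ** W ** transpose ?M))"
    using trace_mul_sym[of "transpose ?M" "P ** ?M ** W"] by (simp only: matrix_mul_assoc)
  ultimately show ?thesis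
    by (simp only: closed_loop_cost_def matrix_add_rdistrib matrix_diff_ldistrib trace_add trace_sub
        matrix_mul_rid)
qed

text \<open>Since \<open>W\<close> dominates the identity, the trace is at least that of the excess
  itself; if it vanishes, so does the excess, and the positive definite weight forces the gains to
  agree.\<close>

lemma trace_excess_nonneg:
  assumes P: "psd P" and W: "psd (W - mat 1)"
  shows "0 \<le> trace (excess P K ** W)" and "trace (excess P K ** W) \<le> 0 \<Longrightarrow> K = gain P"
proof -
  have "trace (excess P K ** W) = trace (excess P K) + trace (excess P K ** (W - mat 1))"
    by (simp add: matrix_diff_ldistrib trace_sub)
  then have le: "trace (excess P K) \<le> trace (excess P K ** W)"
    using trace_psd_mult_nonneg[OF psd_excess[OF P] W] by simp
  then show "0 \<le> trace (excess P K ** W)"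
    using trace_psd_nonneg[OF psd_excess[OF P]] order_trans by blast
  show "K = gain P" if "trace (excess P K ** W) \<le> 0"
  proof -
    have "trace (excess P K) = 0"
      using le that trace_psd_nonneg[OF psd_excess[OF P], of K] by linarith
    then have 0: "excess P K = 0" by (rule psd_trace_zero[OF psd_excess[OF P]])
    have "(K - gain P) *v v = 0" for v
    proof -
      have "((K - gain P) *v v) \<bullet> (weight P *v ((K - gain P) *v v)) = v \<bullet> (excess P K *v v)"
        by (simp only: excess_def dot_congruence_transpose)
      then show ?thesis using pos_def_weight[OF P] 0 unfolding pos_def_def
        by (metis inner_zero_right less_irrefl matrix_vector_mult_0)
    qed
    then show ?thesis by (simp add: matrix_eq matrix_vector_mult_diff_rdistrib)
  qed
qed

lemma H2_norm_closed_loop: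
  assumes "schur_stable (A + B ** K)"
    and W: "W = mat 1 + (A + B ** K) ** W ** transpose (A + B ** K)" "transpose W = W"
  shows "H2_norm (closed_loop_tf A B Qx R K) = sqrt (closed_loop_cost K W)"
proof -
  let ?C = "vstack (psd_sqrt Qx) (psd_sqrt R ** K)"
  have "transpose ?C ** ?C = Qx + transpose K ** (psd_sqrt R ** psd_sqrt R) ** K"
    by (simp only: transpose_vstack_mult matrix_transpose_mul psd_sym[OF psd_psd_sqrt[OF psd_Qx]]
        psd_sym[OF psd_psd_sqrt[OF pos_def_psd[OF pos_def_R]]] psd_sqrt_square[OF psd_Qx] matrix_mul_assoc)
  then have C: "transpose ?C ** ?C = Qx + transpose K ** R ** K"
    by (simp only: psd_sqrt_square[OF pos_def_psd[OF pos_def_R]])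
  have "closed_loop_tf A B Qx R K = (\<lambda>\<zeta>. cmat ?C ** matrix_inv (mat \<zeta> - cmat (A + B ** K)))"
    by (simp add: fun_eq_iff closed_loop_tf_def)
  then have "H2_norm (closed_loop_tf A B Qx R K) = sqrt (trace (transpose ?C ** ?C ** W))"
    by (simp only: H2_norm_stable[OF assms])
  then show ?thesis
    by (simp only: C matrix_add_rdistrib trace_add closed_loop_cost_def)
qed

lemma H2_norm_riccati:
  assumes P: "psd P" "riccati P = P" and stable: "schur_stable (A + B ** K)"
  shows "sqrt (trace P) \<le> H2_norm (closed_loop_tf A B Qx R K)"
    and "H2_norm (closed_loop_tf A B Qx R K) \<le> sqrt (trace P) \<longleftrightarrow> K = gain P"
proof -
  let ?M = "A + B ** K"
  obtain W where W: "W = mat 1 + ?M ** W ** transpose ?M" "psd W" "psd (W - mat 1)"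
    using lyapunov_solution[OF stable] by blast
  have "W - mat 1 = ?M ** W ** transpose ?M"
    using arg_cong[OF W(1), of "\<lambda>X. X - mat 1"] by (simp only: add_diff_cancel_left')
  then have "W - mat 1 - ?M ** W ** transpose ?M = 0" by (rule iffD2[OF right_minus_eq])
  then have cost: "closed_loop_cost K W = trace P + trace (excess P K ** W)"
    unfolding closed_loop_cost_eq[OF P] by (simp add: trace_def matrix_matrix_mult_def)
  note H2 = H2_norm_closed_loop[OF stable W(1) psd_sym[OF W(2)]]
  show "sqrt (trace P) \<le> H2_norm (closed_loop_tf A B Qx R K)"
    unfolding H2 cost using trace_excess_nonneg(1)[OF P(1) W(3)] by simp
  show "H2_norm (closed_loop_tf A B Qx R K) \<le> sqrt (trace P) \<longleftrightarrow> K = gain P"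
    unfolding H2 cost using trace_excess_nonneg(2)[OF P(1) W(3)]
    by (auto simp: excess_def trace_def matrix_matrix_mult_def)
qed

lemma H2_optimal_iff:
  assumes P: "psd P" "riccati P = P" and stable: "schur_stable (A + B ** gain P)"
  shows "H2_optimal A B Qx R K \<longleftrightarrow> K = gain P"
proof
  assume "H2_optimal A B Qx R K"
  then have "schur_stable (A + B ** K)"
    "H2_norm (closed_loop_tf A B Qx R K) \<le> H2_norm (closed_loop_tf A B Qx R (gain P))"
    using stable unfolding H2_optimal_def is_arg_min_def by (auto simp: not_less)
  then show "K = gain P"
    using H2_norm_riccati(2)[OF P] stable order_trans by metis
next
  assume K: "K = gain P"
  then have "H2_norm (closed_loop_tf A B Qx R K) \<le> sqrt (trace P)"
    using H2_norm_riccati(2)[OF P stable] by simp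
  then show "H2_optimal A B Qx R K"
    using stable K H2_norm_riccati(1)[OF P] unfolding H2_optimal_def is_arg_min_def
    by (metis not_le order_trans)
qed

text \<open>With \<open>W = X0 Q\<close> and \<open>K W = U0 Q\<close>, both constraints are Schur complements with respect to \<open>W\<close>.\<close>

lemma sdp_feasible_iff:
  assumes X1: "X1 = A ** X0 + B ** U0" and W: "X0 ** Q = W" "psd W" and K: "U0 ** Q = K ** W"
  shows "sdp_feasible R U0 X0 X1 (Q, X) \<longleftrightarrow>
     psd (X - (psd_sqrt R ** K) ** W ** transpose (psd_sqrt R ** K)) \<and>
     psd (W - mat 1 - (A + B ** K) ** W ** transpose (A + B ** K))"
proof -
  let ?S = "psd_sqrt R"
  note S = psd_sym[OF psd_psd_sqrt[OF pos_def_psd[OF pos_def_R]]]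
  have 1: "?S ** U0 ** Q = (?S ** K) ** W"
    by (simp only: matrix_mul_assoc[symmetric] K)
  have "transpose Q ** transpose U0 ** ?S = transpose (?S ** U0 ** Q)"
    by (simp add: matrix_transpose_mul S matrix_mul_assoc)
  then have 2: "transpose Q ** transpose U0 ** ?S = W ** transpose (?S ** K)"
    unfolding 1 by (simp only: matrix_transpose_mul[of _ W] psd_sym[OF W(2)])
  have 3: "X1 ** Q = (A + B ** K) ** W"
    by (simp only: X1 matrix_add_rdistrib matrix_mul_assoc[symmetric] W K)
  have "transpose Q ** transpose X1 = transpose (X1 ** Q)"
    by (simp only: matrix_transpose_mul)
  then have 4: "transpose Q ** transpose X1 = W ** transpose (A + B ** K)"
    unfolding 3 by (simp only: matrix_transpose_mul[of _ W] psd_sym[OF W(2)])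
  show ?thesis
    unfolding sdp_feasible_def prod.case W(1) 1 2 3 4 psd_Schur_complement[OF W(2)] ..
qed

text \<open>The first diagonal block of the second constraint, obtained by setting \<open>b\<close>
  to 0.\<close>

lemma sdp_feasible_gram_ge_one:
  assumes "sdp_feasible R U0 X0 X1 (Q, X)" shows "psd (X0 ** Q - mat 1)"
proof -
  have "psd (block2 (X0 ** Q - mat 1) (X1 ** Q) (transpose Q ** transpose X1) (X0 ** Q))"
    using assms by (simp add: sdp_feasible_def)
  then have "transpose (X0 ** Q - mat 1) = X0 ** Q - mat 1"
    and nonneg: "\<And>a b. 0 \<le> a \<bullet> ((X0 ** Q - mat 1) *v a) + a \<bullet> ((X1 ** Q) *v b)
      + b \<bullet> ((transpose Q ** transpose X1) *v a) + b \<bullet> ((X0 ** Q) *v b)"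
    unfolding psd_block2_iff by blast+
  then show ?thesis using nonneg[of _ 0] by (simp add: psd_def)
qed

text \<open>The trace of \<open>X\<close> splits into the slack of the first constraint and, by
  cyclicity, the input part of the closed-loop cost.\<close>

lemma sdp_cost_eq:
  assumes W: "X0 ** Q = W"
  shows "sdp_cost Qx X0 (Q, X) = closed_loop_cost K W
     + trace (X - (psd_sqrt R ** K) ** W ** transpose (psd_sqrt R ** K))"
proof -
  let ?S = "psd_sqrt R"
  note R = pos_def_psd[OF pos_def_R]
  have "trace ((?S ** K) ** W ** transpose (?S ** K)) = trace (transpose (?S ** K) ** ((?S ** K) ** W))"
    by (rule trace_mul_sym)
  also have "transpose (?S ** K) ** ((?S ** K) ** W) = transpose K ** (?S ** ?S) ** K ** W"
    by (simp add: matrix_transpose_mul psd_sym[OF psd_psd_sqrt[OF R]] matrix_mul_assoc)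
  finally show ?thesis
    unfolding sdp_cost_def prod.case closed_loop_cost_def psd_sqrt_square[OF R]
    by (simp add: trace_sub W flip: matrix_mul_assoc[of Qx])
qed

lemma ge_one_imp_psd_invertible:
  assumes "psd (W - mat 1)" shows "psd W" "invertible W"
proof -
  have "pos_def (mat 1 + (W - mat 1))"
    by (rule pos_def_add_psd[OF _ assms]) (simp add: pos_def_def)
  then have "pos_def W" by simp
  then show "psd W" "invertible W" by (rule pos_def_psd, rule pos_def_invertible)
qed

text \<open>The cost exceeds \<open>trace P\<close> by three nonnegative terms: the slack in
  \<open>X\<close>, the slack in the Lyapunov inequality weighted by \<open>P\<close>, and the
  excess of the gain. Equality makes the last one vanish.\<close>

lemma sdp_cost_lower_bound:
  assumes P: "psd P" "riccati P = P" and X1: "X1 = A ** X0 + B ** U0"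
    and feas: "sdp_feasible R U0 X0 X1 (Q, X)"
  shows "trace P \<le> sdp_cost Qx X0 (Q, X)"
    and "sdp_cost Qx X0 (Q, X) \<le> trace P \<Longrightarrow> U0 ** Q ** matrix_inv (X0 ** Q) = gain P"
proof -
  define W where "W = X0 ** Q"
  define K where "K = U0 ** Q ** matrix_inv W"
  let ?M = "A + B ** K"
  have W1: "psd (W - mat 1)"
    unfolding W_def by (rule sdp_feasible_gram_ge_one[OF feas])
  note W = ge_one_imp_psd_invertible[OF W1]
  have "U0 ** Q = K ** W"
    unfolding K_def by (simp add: matrix_inv_mult[OF W(2)] flip: matrix_mul_assoc[of _ _ W])
  then have "psd (X - (psd_sqrt R ** K) ** W ** transpose (psd_sqrt R ** K))"
    and lyap: "psd (W - mat 1 - ?M ** W ** transpose ?M)"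
    using feas sdp_feasible_iff[OF X1 W_def[symmetric] W(1)] by blast+
  then have "closed_loop_cost K W \<le> sdp_cost Qx X0 (Q, X)"
    unfolding sdp_cost_eq[OF W_def[symmetric], of X K] using trace_psd_nonneg by simp
  moreover have "trace P + trace (excess P K ** W) \<le> closed_loop_cost K W"
    unfolding closed_loop_cost_eq[OF P] using trace_psd_mult_nonneg[OF P(1) lyap] by simp
  ultimately have le: "trace P + trace (excess P K ** W) \<le> sdp_cost Qx X0 (Q, X)"
    by (rule order_trans[rotated])
  then show "trace P \<le> sdp_cost Qx X0 (Q, X)"
    using trace_excess_nonneg(1)[OF P(1) W1, of K] by linarith
  show "U0 ** Q ** matrix_inv (X0 ** Q) = gain P" if "sdp_cost Qx X0 (Q, X) \<le> trace P"
    using trace_excess_nonneg(2)[OF P(1) W1, of K] le that unfolding K_def W_def by linarith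
qed

lemma sdp_attained:
  assumes P: "psd P" "riccati P = P" and stable: "schur_stable (A + B ** gain P)"
    and X1: "X1 = A ** X0 + B ** U0"
    and surj: "\<And>Y (W :: real^'n^'n). \<exists>Q. U0 ** Q = Y \<and> X0 ** Q = W"
  obtains Q X where "sdp_feasible R U0 X0 X1 (Q, X)" "sdp_cost Qx X0 (Q, X) = trace P"
proof -
  let ?K = "gain P" let ?M = "A + B ** ?K"
  obtain W where W: "W = mat 1 + ?M ** W ** transpose ?M" "psd W" "psd (W - mat 1)"
    using lyapunov_solution[OF stable] by blast
  have "W - mat 1 = ?M ** W ** transpose ?M"
    using arg_cong[OF W(1), of "\<lambda>X. X - mat 1"] by (simp only: add_diff_cancel_left')
  then have 0: "W - mat 1 - ?M ** W ** transpose ?M = 0" by (rule iffD2[OF right_minus_eq])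
  obtain Q where Q: "U0 ** Q = ?K ** W" "X0 ** Q = W" using surj by blast
  \<comment> \<open>The least \<open>X\<close> allowed by the first constraint, so that both slacks
    are 0.\<close>
  let ?X = "(psd_sqrt R ** ?K) ** W ** transpose (psd_sqrt R ** ?K)"
  show ?thesis
  proof (rule that)
    show "sdp_feasible R U0 X0 X1 (Q, ?X)"
      unfolding sdp_feasible_iff[OF X1 Q(2) W(2) Q(1)] 0 by simp
    show "sdp_cost Qx X0 (Q, ?X) = trace P"
      unfolding sdp_cost_eq[OF Q(2), of _ ?K] closed_loop_cost_eq[OF P] 0
      by (simp add: excess_def trace_def matrix_matrix_mult_def)
  qed
qed

end

section \<open>From data matrices to the program\<close>

lemma vstack_full_rank_surj:
  fixes U0 :: "real^'t^'m" and X0 :: "real^'t^'n"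
  assumes "rank (vstack U0 X0) = CARD('n) + CARD('m)"
  shows "\<exists>Q. U0 ** Q = Y \<and> X0 ** Q = W"
proof -
  have "surj ((*v) (vstack U0 X0))"
    unfolding full_rank_surjective[symmetric] assms by simp
  \<comment> \<open>Full row rank provides a right inverse Z, and Q is Z times the stacked
    targets.\<close>
  then obtain Z where "vstack U0 X0 ** Z = mat 1"
    using matrix_right_invertible_surjective by blast
  then have "vstack U0 X0 ** (Z ** vstack Y W) = vstack Y W"
    by (simp add: matrix_mul_assoc)
  then show ?thesis by (auto simp: vstack_mult vstack_eq_iff)
qed

lemma data_matrix_dynamics:
  assumes "\<And>k. k < CARD('t::{finite,linorder}) \<Longrightarrow> x (k + 1) = A *v x k + B *v u k"
  shows "(data_matrix (\<lambda>k. x (k + 1)) :: (real, 't) vec^'n) = A ** data_matrix x + B ** data_matrix u"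
proof -
  \<comment> \<open>Every column thus carries a sampling instant at which the dynamics are
    assumed.\<close>
  have "instant t < CARD('t)" for t :: 't
    using bij_betw_instant[where 't = 't] by (auto simp: bij_betw_def)
  then have "x (instant t + 1) = A *v x (instant t) + B *v u (instant t)" for t :: 't
    by (rule assms)
  then show ?thesis
    by (simp add: vec_eq_iff data_matrix_def matrix_matrix_mult_def matrix_vector_mult_def)
qed

theorem theorem4:
  fixes A :: "real^'n^'n" and B :: "real^'m^'n"
    and Qx :: "real^'n^'n" and R :: "real^'m^'m"
    and u\<^sub>d :: "nat \<Rightarrow> real^'m" and x\<^sub>d :: "nat \<Rightarrow> real^'n"
    and U0 :: "(real, 't::{finite,linorder}) vec^'m"
    and X0 X1 :: "(real, 't) vec^'n"
  assumes "controllable A B"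
    and "psd Qx" and "pos_def R" and "observable Qx A"
    and "\<And>k. k < CARD('t) \<Longrightarrow> x\<^sub>d (k + 1) = A *v x\<^sub>d k + B *v u\<^sub>d k"
    and "U0 = data_matrix u\<^sub>d"
    and "X0 = data_matrix x\<^sub>d"
    and "X1 = data_matrix (\<lambda>k. x\<^sub>d (k + 1))"
    and "rank (vstack U0 X0) = CARD('n) + CARD('m)"
  shows "(\<exists>Q X. sdp_optimal Qx R U0 X0 X1 (Q, X)) \<and>
         (\<forall>Q X. sdp_optimal Qx R U0 X0 X1 (Q, X) \<longrightarrow>
            invertible (X0 ** Q) \<and>
            (\<forall>K. H2_optimal A B Qx R K \<longleftrightarrow> K = U0 ** Q ** matrix_inv (X0 ** Q)))"
proof -
  interpret linear_quadratic A B Qx R by unfold_locales fact+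
  obtain P where P: "psd P" "riccati P = P" by (rule riccati_solution[OF assms(1)])
  note stable = riccati_stable[OF assms(4) P]
  have X1: "X1 = A ** X0 + B ** U0"
    unfolding assms(6-8) by (intro data_matrix_dynamics assms(5))
  note bound = sdp_cost_lower_bound[OF P X1]
  obtain Q' X' where opt: "sdp_feasible R U0 X0 X1 (Q', X')" "sdp_cost Qx X0 (Q', X') = trace P"
    using sdp_attained[OF P stable X1 vstack_full_rank_surj[OF assms(9)]] by blast
  have "sdp_optimal Qx R U0 X0 X1 (Q', X')"
    using opt bound(1) unfolding sdp_optimal_def is_arg_min_def by (auto simp: not_less)
  moreover have "invertible (X0 ** Q) \<and>
      (\<forall>K. H2_optimal A B Qx R K \<longleftrightarrow> K = U0 ** Q ** matrix_inv (X0 ** Q))"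
    if "sdp_optimal Qx R U0 X0 X1 (Q, X)" for Q X
  proof -
    have feas: "sdp_feasible R U0 X0 X1 (Q, X)"
      using that unfolding sdp_optimal_def is_arg_min_def by blast
    \<comment> \<open>Comparison with the pair of cost \<open>trace P\<close> puts every optimal
      pair in the equality case of the lower bound.\<close>
    have "sdp_cost Qx X0 (Q, X) \<le> sdp_cost Qx X0 (Q', X')"
      using that opt(1) unfolding sdp_optimal_def is_arg_min_def by (auto simp: not_less)
    then have "U0 ** Q ** matrix_inv (X0 ** Q) = gain P"
      using bound(2)[OF feas] opt(2) by simp
    then show ?thesis
      using ge_one_imp_psd_invertible(2)[OF sdp_feasible_gram_ge_one[OF feas]] H2_optimal_iff[OF P stable] by simp
  qed
  ultimately show ?thesis by blast
qed

end
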